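(* Let $(A,C,\psi)$ be an entwining structure over a field $k$. Then $\mathscr I^\bullet(A,C,\psi)$, with the cofaces $\delta_i$, the codegeneracies $\sigma_j$ and the cyclic operators $\tau_n$, is a cocyclic module.
   Context: Let $k$ be a field; $\otimes$ and $Hom$ are over $k$. An entwining structure $(A,C,\psi)$ over $k$ consists of a unital associative $k$-algebra $A$ with product $\theta$, a counital coassociative $k$-coalgebra $C$ (coproduct $\Delta$, counit $\varepsilon$), and a $k$-linear map $\psi:C\otimes A\to A\otimes C$, written $\psi(c\otimes a)=a_\psi\otimes c^\psi$ with summation suppressed, such that: (i) $\psi\circ(id_C\otimes\theta)=(\theta\otimes id_C)\circ(id_A\otimes\psi)\circ(\psi\otimes id_A)$; (ii) $(id_A\otimes\Delta)\circ\psi=(\psi\otimes id_C)\circ(id_C\otimes\psi)\circ(\Delta\otimes id_A)$; (iii) $a_\psi\,\varepsilon(c^\psi)=\varepsilon(c)a$; (iv) $1_\psi\otimes c^\psi=1\otimes c$. Iterating, $a_{1\psi}\otimes\cdots\otimes a_{m\psi}\otimes c^{\psi^m}$ denotes the image of $c\otimes a_1\otimes\cdots\otimes a_m$ under the map $C\otimes A^{\otimes m}\to A^{\otimes m}\otimes C$ that moves $C$ past $a_1$, then $a_2$, ..., then $a_m$ by $\psi$. Let $\mathscr C^n(A,C,\psi)=Hom(C\otimes A^{\otimes n+1},k)$ and let $\delta_i:\mathscr C^n\to\mathscr C^{n+1}$, $0\le i\le n+1$, be $(\delta_0g)(c\otimes a_1\otimes\cdots\otimes a_{n+2})=g(c^\psi\otimes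 a_2\otimes\cdots\otimes a_{n+2}a_{1\psi})$ and $(\delta_ig)(c\otimes a_1\otimes\cdots\otimes a_{n+2})=g(c\otimes a_1\otimes\cdots\otimes a_ia_{i+1}\otimes\cdots\otimes a_{n+2})$ for $1\le i\le n+1$. Let $\mathscr I^n(A,C,\psi)\subseteq\mathscr C^n(A,C,\psi)$ be the subspace of $g$ with $g(c\otimes a_1\otimes\cdots\otimes a_{n+1})=g(c^{\psi^{n+1}}\otimes a_{1\psi}\otimes\cdots\otimes a_{n+1\,\psi})$ for all $c,a_i$; the $\delta_i$ restrict to it. Further $\sigma_j:\mathscr I^{n+1}\to\mathscr I^n$, $0\le j\le n$, is $(\sigma_jf)(c\otimes a_1\otimes\cdots\otimes a_{n+1})=f(c\otimes a_1\otimes\cdots\otimes a_j\otimes1_A\otimes a_{j+1}\otimes\cdots\otimes a_{n+1})$, and $\tau_n:\mathscr I^n\to\mathscr I^n$ is $(\tau_ng)(c\otimes a_1\otimes\cdots\otimes a_{n+1})=(-1)^ng(c^\psi\otimes a_2\otimes\cdots\otimes a_{n+1}\otimes a_{1\psi})$. Cocyclic module here means: a cosimplicial $k$-module (the $\delta_i,\sigma_j$ satisfy the usual cosimplicial identities) with operators $\tau_n$ such that $\tau_n^{n+1}=id$; $\delta_i\tau_{n-1}=-\tau_n\delta_{i-1}$ for $1\le i\le n$; $\delta_0=(-1)^n\tau_n\delta_n$ (on $\mathscr I^{n-1}$); $\sigma_i\tau_{n+1}=-\tau_n\sigma_{i-1}$ for $1\le i\le n$; and $\sigma_0\tau_{n+1}^2=(-1)^n\tau_n\sigma_n$.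 *)

theory Defs
  imports Complex_Main "HOL-Library.Poly_Mapping" "HOL-Library.Function_Algebras"
begin

section \<open>Tensor products of copies of two vector spaces\<close>

text \<open>
  A vector space over the field \<open>'k\<close> is a type together with a scalar multiplication. Let \<open>A\<close>
  and \<open>C\<close> be two such spaces. A word in the elements of \<open>A\<close> and \<open>C\<close> has a shape, recording which
  entries come from which space; the words of shape \<open>p\<close> form the cartesian product
  of the corresponding spaces. The tensor product \<open>T p\<close> of these spaces is the free vector space
  on the words of shape \<open>p\<close>, modulo the multilinearity relations; its elements are the cosets.

  We divide by the multilinearity relations for all shapes at once. Each single relation only
  involves words of one shape, so on formal sums of words of shape \<open>p\<close> this is the same as dividing
  by the relations of shape \<open>p\<close>. In this way the tensor products of all shapes live in one type, the
  unitors and associators are identities, \<open>T [Coalgebra]\<close> is a copy of \<open>C\<close> and \<open>T []\<close> is a copy of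
  the ground field.
\<close>

datatype ('a, 'c) letter = Alg (alg: 'a) | Coalg (coalg: 'c)

datatype kind = Algebra | Coalgebra

fun kind_of :: "('a, 'c) letter \<Rightarrow> kind" where
  "kind_of (Alg a) = Algebra"
| "kind_of (Coalg c) = Coalgebra"

definition words :: "kind list \<Rightarrow> ('a, 'c) letter list set" where
  "words p = {w. map kind_of w = p}"

type_synonym ('a, 'c, 'k) formal = "('a, 'c) letter list \<Rightarrow>\<^sub>0 'k"
type_synonym ('a, 'c, 'k) tensor = "('a, 'c, 'k) formal set"

definition fscale :: "'k::field \<Rightarrow> ('x \<Rightarrow>\<^sub>0 'k) \<Rightarrow> ('x \<Rightarrow>\<^sub>0 'k)" where
  "fscale r = Poly_Mapping.map ((*) r)"

text \<open>Concatenation of words, extended bilinearly.\<close>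

definition fconcat :: "('x list \<Rightarrow>\<^sub>0 'k::field) \<Rightarrow> ('x list \<Rightarrow>\<^sub>0 'k) \<Rightarrow> ('x list \<Rightarrow>\<^sub>0 'k)" where
  "fconcat f g = (\<Sum>u\<in>Poly_Mapping.keys f. \<Sum>v\<in>Poly_Mapping.keys g.
     Poly_Mapping.single (u @ v) (Poly_Mapping.lookup f u * Poly_Mapping.lookup g v))"

locale tensor_words =
  fixes sA :: "'k::field \<Rightarrow> 'a::ab_group_add \<Rightarrow> 'a"
    and sC :: "'k \<Rightarrow> 'c::ab_group_add \<Rightarrow> 'c"
begin

definition relations :: "('a, 'c, 'k) formal set" where
  "relations =
     {Poly_Mapping.single (u @ [Alg (x + y)] @ v) 1 - Poly_Mapping.single (u @ [Alg x] @ v) 1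
        - Poly_Mapping.single (u @ [Alg y] @ v) 1 | u v x y. True}
   \<union> {Poly_Mapping.single (u @ [Alg (sA r x)] @ v) 1 - Poly_Mapping.single (u @ [Alg x] @ v) r
        | u v r x. True}
   \<union> {Poly_Mapping.single (u @ [Coalg (x + y)] @ v) 1 - Poly_Mapping.single (u @ [Coalg x] @ v) 1
        - Poly_Mapping.single (u @ [Coalg y] @ v) 1 | u v x y. True}
   \<union> {Poly_Mapping.single (u @ [Coalg (sC r x)] @ v) 1 - Poly_Mapping.single (u @ [Coalg x] @ v) r
        | u v r x. True}"

definition null :: "('a, 'c, 'k) formal set" where
  "null = module.span fscale relations"

definition coset :: "('a, 'c, 'k) formal \<Rightarrow> ('a, 'c, 'k) tensor" where
  "coset f = {g. g - f \<in> null}"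

definition T :: "kind list \<Rightarrow> ('a, 'c, 'k) tensor set" where
  "T p = coset ` {f. Poly_Mapping.keys f \<subseteq> words p}"

definition pure_tensor :: "('a, 'c) letter list \<Rightarrow> ('a, 'c, 'k) tensor" where
  "pure_tensor w = coset (Poly_Mapping.single w 1)"

definition tadd :: "('a, 'c, 'k) tensor \<Rightarrow> ('a, 'c, 'k) tensor \<Rightarrow> ('a, 'c, 'k) tensor" where
  "tadd s t = {h. \<exists>f\<in>s. \<exists>g\<in>t. h - (f + g) \<in> null}"

definition tscale :: "'k \<Rightarrow> ('a, 'c, 'k) tensor \<Rightarrow> ('a, 'c, 'k) tensor" where
  "tscale r t = {h. \<exists>f\<in>t. h - fscale r f \<in> null}"

text \<open>The canonical bilinear map from \<open>T p \<times> T q\<close> to \<open>T (p @ q)\<close>, with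
  \<open>pure_tensor u \<otimes> pure_tensor v = pure_tensor (u @ v)\<close>.\<close>

definition tconcat :: "('a, 'c, 'k) tensor \<Rightarrow> ('a, 'c, 'k) tensor \<Rightarrow> ('a, 'c, 'k) tensor"
    (infixr "\<otimes>" 70) where
  "s \<otimes> t = {h. \<exists>f\<in>s. \<exists>g\<in>t. h - fconcat f g \<in> null}"

text \<open>For multilinear \<open>\<phi>\<close>, \<open>lift p \<phi>\<close> is the induced linear map on \<open>T p\<close>, i.e. the one
  with \<open>lift p \<phi> (pure_tensor w) = \<phi> w\<close> for \<open>w \<in> words p\<close>. It is computed from an arbitrary
  representative of shape \<open>p\<close>.\<close>

definition lift :: "kind list \<Rightarrow> (('a, 'c) letter list \<Rightarrow> ('a, 'c, 'k) tensor)
    \<Rightarrow> ('a, 'c, 'k) tensor \<Rightarrow> ('a, 'c, 'k) tensor" where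
  "lift p \<phi> t =
     (let f = (SOME f. f \<in> t \<and> Poly_Mapping.keys f \<subseteq> words p)
      in coset (\<Sum>w\<in>Poly_Mapping.keys f. fscale (Poly_Mapping.lookup f w) (SOME h. h \<in> \<phi> w)))"

definition linear_map :: "kind list \<Rightarrow> kind list
    \<Rightarrow> (('a, 'c, 'k) tensor \<Rightarrow> ('a, 'c, 'k) tensor) \<Rightarrow> bool" where
  "linear_map p q F \<longleftrightarrow>
     (\<forall>t\<in>T p. F t \<in> T q) \<and>
     (\<forall>s\<in>T p. \<forall>t\<in>T p. F (tadd s t) = tadd (F s) (F t)) \<and>
     (\<forall>r. \<forall>t\<in>T p. F (tscale r t) = tscale r (F t))"

text \<open>The tensor product of linear maps \<open>F\<close> and \<open>G\<close> defined on \<open>T p\<close> and \<open>T q\<close>.\<close>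

definition tensor_map :: "kind list \<Rightarrow> kind list
    \<Rightarrow> (('a, 'c, 'k) tensor \<Rightarrow> ('a, 'c, 'k) tensor) \<Rightarrow> (('a, 'c, 'k) tensor \<Rightarrow> ('a, 'c, 'k) tensor)
    \<Rightarrow> ('a, 'c, 'k) tensor \<Rightarrow> ('a, 'c, 'k) tensor" where
  "tensor_map p q F G = lift (p @ q)
     (\<lambda>w. F (pure_tensor (take (length p) w)) \<otimes> G (pure_tensor (drop (length p) w)))"

end


section \<open>Entwining structures\<close>

text \<open>The sort \<open>{ring, monoid_mult}\<close> is that of unital rings in which \<open>0 = 1\<close> is permitted.\<close>

locale k_algebra = vector_space scale
  for scale :: "'k::field \<Rightarrow> 'a::{ring, monoid_mult} \<Rightarrow> 'a" +
  assumes scale_mult_left: "scale r x * y = scale r (x * y)"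
    and scale_mult_right: "x * scale r y = scale r (x * y)"

locale entwining_data = tensor_words sA sC
  for sA :: "'k::field \<Rightarrow> 'a::{ring, monoid_mult} \<Rightarrow> 'a"
    and sC :: "'k \<Rightarrow> 'c::ab_group_add \<Rightarrow> 'c" +
  fixes \<Delta> :: "'c \<Rightarrow> ('a, 'c, 'k) tensor"
    and \<epsilon> :: "'c \<Rightarrow> 'k"
    and \<psi> :: "('a, 'c, 'k) tensor \<Rightarrow> ('a, 'c, 'k) tensor"
begin

text \<open>The product, coproduct and counit as maps \<open>T [Algebra, Algebra] \<rightarrow> T [Algebra]\<close>,
  \<open>T [Coalgebra] \<rightarrow> T [Coalgebra, Coalgebra]\<close> and \<open>T [Coalgebra] \<rightarrow> T []\<close>.\<close>

definition product_map :: "('a, 'c, 'k) tensor \<Rightarrow> ('a, 'c, 'k) tensor" where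
  "product_map = lift [Algebra, Algebra] (\<lambda>w. pure_tensor [Alg (alg (w ! 0) * alg (w ! 1))])"

definition coproduct_map :: "('a, 'c, 'k) tensor \<Rightarrow> ('a, 'c, 'k) tensor" where
  "coproduct_map = lift [Coalgebra] (\<lambda>w. \<Delta> (coalg (w ! 0)))"

definition counit_map :: "('a, 'c, 'k) tensor \<Rightarrow> ('a, 'c, 'k) tensor" where
  "counit_map = lift [Coalgebra] (\<lambda>w. tscale (\<epsilon> (coalg (w ! 0))) (pure_tensor []))"

end

locale entwining_structure = entwining_data sA sC \<Delta> \<epsilon> \<psi> + k_algebra sA + C: vector_space sC
  for sA :: "'k::field \<Rightarrow> 'a::{ring, monoid_mult} \<Rightarrow> 'a"
    and sC :: "'k \<Rightarrow> 'c::ab_group_add \<Rightarrow> 'c"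
    and \<Delta> \<epsilon> \<psi> +
  assumes coproduct_in: "\<Delta> c \<in> T [Coalgebra, Coalgebra]"
    and coproduct_add: "\<Delta> (c + d) = tadd (\<Delta> c) (\<Delta> d)"
    and coproduct_scale: "\<Delta> (sC r c) = tscale r (\<Delta> c)"
    and counit_linear: "Vector_Spaces.linear sC (*) \<epsilon>"
    and coassociative:
      "tensor_map [Coalgebra] [Coalgebra] coproduct_map id (\<Delta> c)
       = tensor_map [Coalgebra] [Coalgebra] id coproduct_map (\<Delta> c)"
    and counital_left:
      "tensor_map [Coalgebra] [Coalgebra] counit_map id (\<Delta> c) = pure_tensor [Coalg c]"
    and counital_right:
      "tensor_map [Coalgebra] [Coalgebra] id counit_map (\<Delta> c) = pure_tensor [Coalg c]"
    and entwining_linear: "linear_map [Coalgebra, Algebra] [Algebra, Coalgebra] \<psi>"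
    and entwining_product:
      "t \<in> T [Coalgebra, Algebra, Algebra] \<Longrightarrow>
       \<psi> (tensor_map [Coalgebra] [Algebra, Algebra] id product_map t)
       = tensor_map [Algebra, Algebra] [Coalgebra] product_map id
           (tensor_map [Algebra] [Coalgebra, Algebra] id \<psi>
             (tensor_map [Coalgebra, Algebra] [Algebra] \<psi> id t))"
    and entwining_coproduct:
      "t \<in> T [Coalgebra, Algebra] \<Longrightarrow>
       tensor_map [Algebra] [Coalgebra] id coproduct_map (\<psi> t)
       = tensor_map [Coalgebra, Algebra] [Coalgebra] \<psi> id
           (tensor_map [Coalgebra] [Coalgebra, Algebra] id \<psi>
             (tensor_map [Coalgebra] [Algebra] coproduct_map id t))"
    and entwining_counit:
      "tensor_map [Algebra] [Coalgebra] id counit_map (\<psi> (pure_tensor [Coalg c, Alg a]))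
       = tscale (\<epsilon> c) (pure_tensor [Alg a])"
    and entwining_unit:
      "\<psi> (pure_tensor [Coalg c, Alg 1]) = pure_tensor [Alg 1, Coalg c]"


section \<open>The invariant cochains and their operators\<close>

context entwining_data
begin

text \<open>\<open>CA m\<close> is the shape of \<open>C \<otimes> A\<^sup>\<otimes>\<^sup>m\<close>, and \<open>word c as\<close> is its generator
  \<open>c \<otimes> a\<^sub>1 \<otimes> \<dots> \<otimes> a\<^sub>m\<close>.\<close>

definition CA :: "nat \<Rightarrow> kind list" where
  "CA m = Coalgebra # replicate m Algebra"

definition word :: "'c \<Rightarrow> 'a list \<Rightarrow> ('a, 'c) letter list" where
  "word c as = Coalg c # map Alg as"

definition lift_CA :: "nat \<Rightarrow> ('c \<Rightarrow> 'a list \<Rightarrow> ('a, 'c, 'k) tensor)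
    \<Rightarrow> ('a, 'c, 'k) tensor \<Rightarrow> ('a, 'c, 'k) tensor" where
  "lift_CA m \<phi> = lift (CA m) (\<lambda>w. \<phi> (coalg (hd w)) (map alg (tl w)))"

text \<open>\<open>sweedler c a B\<close> is \<open>B(a\<^sub>\<psi>, c\<^sup>\<psi>)\<close>, with summation as in the Sweedler-type notation
  \<open>\<psi>(c \<otimes> a) = a\<^sub>\<psi> \<otimes> c\<^sup>\<psi>\<close>, for bilinear \<open>B\<close>.\<close>

definition sweedler :: "'c \<Rightarrow> 'a \<Rightarrow> ('a \<Rightarrow> 'c \<Rightarrow> ('a, 'c, 'k) tensor) \<Rightarrow> ('a, 'c, 'k) tensor" where
  "sweedler c a B = lift [Algebra, Coalgebra] (\<lambda>w. B (alg (w ! 0)) (coalg (w ! 1)))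
     (\<psi> (pure_tensor [Coalg c, Alg a]))"

text \<open>\<open>C \<otimes> A\<^sup>\<otimes>\<^sup>m \<rightarrow> A\<^sup>\<otimes>\<^sup>m \<otimes> C\<close>, moving \<open>C\<close> past the factors \<open>A\<close> one after the other.\<close>

fun move :: "nat \<Rightarrow> ('a, 'c, 'k) tensor \<Rightarrow> ('a, 'c, 'k) tensor" where
  "move 0 t = t"
| "move (Suc m) t =
     tensor_map (replicate m Algebra) [Coalgebra, Algebra] id \<psi>
       (tensor_map (CA m) [Algebra] (move m) id t)"

text \<open>The flip \<open>A\<^sup>\<otimes>\<^sup>m \<otimes> C \<rightarrow> C \<otimes> A\<^sup>\<otimes>\<^sup>m\<close>.\<close>

definition flip :: "nat \<Rightarrow> ('a, 'c, 'k) tensor \<Rightarrow> ('a, 'c, 'k) tensor" where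
  "flip m = lift (replicate m Algebra @ [Coalgebra]) (\<lambda>w. pure_tensor (last w # butlast w))"

text \<open>Linear functionals on \<open>C \<otimes> A\<^sup>\<otimes>\<^sup>n\<^sup>+\<^sup>1\<close>, normalised to be zero outside this
  space so that equality of functions is equality of functionals.\<close>

definition cochains :: "nat \<Rightarrow> (('a, 'c, 'k) tensor \<Rightarrow> 'k) set" where
  "cochains n = {g.
     (\<forall>s\<in>T (CA (n + 1)). \<forall>t\<in>T (CA (n + 1)). g (tadd s t) = g s + g t) \<and>
     (\<forall>r. \<forall>t\<in>T (CA (n + 1)). g (tscale r t) = r * g t) \<and>
     (\<forall>t. t \<notin> T (CA (n + 1)) \<longrightarrow> g t = 0)}"

definition invariant_cochains :: "nat \<Rightarrow> (('a, 'c, 'k) tensor \<Rightarrow> 'k) set" where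
  "invariant_cochains n = {g \<in> cochains n. \<forall>c as. length as = n + 1 \<longrightarrow>
     g (pure_tensor (word c as)) = g (flip (n + 1) (move (n + 1) (pure_tensor (word c as))))}"

text \<open>The linear maps of which the cofaces, codegeneracies and cyclic operators are the transposes.
  Lists are indexed from 0, so that \<open>a\<^sub>i\<close> is \<open>as ! (i - 1)\<close>.\<close>

definition face :: "nat \<Rightarrow> nat \<Rightarrow> ('a, 'c, 'k) tensor \<Rightarrow> ('a, 'c, 'k) tensor" where
  "face n i = lift_CA (n + 2) (\<lambda>c as.
     if i = 0
     then sweedler c (hd as) (\<lambda>a' c'. pure_tensor (word c' (butlast (tl as) @ [last (tl as) * a'])))
     else pure_tensor (word c (take (i - 1) as @ [as ! (i - 1) * as ! i] @ drop (i + 1) as)))"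

definition degeneracy :: "nat \<Rightarrow> nat \<Rightarrow> ('a, 'c, 'k) tensor \<Rightarrow> ('a, 'c, 'k) tensor" where
  "degeneracy n j = lift_CA (n + 1) (\<lambda>c as. pure_tensor (word c (take j as @ [1] @ drop j as)))"

definition rotation :: "nat \<Rightarrow> ('a, 'c, 'k) tensor \<Rightarrow> ('a, 'c, 'k) tensor" where
  "rotation n = lift_CA (n + 1) (\<lambda>c as.
     sweedler c (hd as) (\<lambda>a' c'. pure_tensor (word c' (tl as @ [a']))))"

text \<open>\<open>coface n i\<close> goes from degree \<open>n\<close> to degree \<open>n + 1\<close>, \<open>codegeneracy n j\<close> from degree \<open>n + 1\<close>
  to degree \<open>n\<close>.\<close>

definition coface :: "nat \<Rightarrow> nat \<Rightarrow> (('a, 'c, 'k) tensor \<Rightarrow> 'k) \<Rightarrow> (('a, 'c, 'k) tensor \<Rightarrow> 'k)" where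
  "coface n i g = (\<lambda>t. if t \<in> T (CA (n + 2)) then g (face n i t) else 0)"

definition codegeneracy :: "nat \<Rightarrow> nat \<Rightarrow> (('a, 'c, 'k) tensor \<Rightarrow> 'k) \<Rightarrow> (('a, 'c, 'k) tensor \<Rightarrow> 'k)"
  where "codegeneracy n j f = (\<lambda>t. if t \<in> T (CA (n + 1)) then f (degeneracy n j t) else 0)"

definition cyclic_operator :: "nat \<Rightarrow> (('a, 'c, 'k) tensor \<Rightarrow> 'k) \<Rightarrow> (('a, 'c, 'k) tensor \<Rightarrow> 'k)" where
  "cyclic_operator n g = (\<lambda>t. if t \<in> T (CA (n + 1)) then (- 1) ^ n * g (rotation n t) else 0)"

end


section \<open>Cocyclic modules\<close>

definition linear_between ::
    "('k::field \<Rightarrow> 'm::ab_group_add \<Rightarrow> 'm) \<Rightarrow> 'm set \<Rightarrow> 'm set \<Rightarrow> ('m \<Rightarrow> 'm) \<Rightarrow> bool" where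
  "linear_between scale M N F \<longleftrightarrow>
     (\<forall>x\<in>M. F x \<in> N) \<and>
     (\<forall>x\<in>M. \<forall>y\<in>M. F (x + y) = F x + F y) \<and>
     (\<forall>r. \<forall>x\<in>M. F (scale r x) = scale r (F x))"

text \<open>The modules \<open>M n\<close> are subspaces of an ambient vector space. The operators are
  \<open>\<delta> n i : M n \<rightarrow> M (n + 1)\<close>, \<open>\<sigma> n j : M (n + 1) \<rightarrow> M n\<close> and \<open>\<tau> n : M n \<rightarrow> M n\<close>; identities
  involving a degree \<open>n - 1\<close> are shifted up by one.\<close>

locale cosimplicial_module = vector_space scale
  for scale :: "'k::field \<Rightarrow> 'm::ab_group_add \<Rightarrow> 'm" +
  fixes M :: "nat \<Rightarrow> 'm set"
    and \<delta> \<sigma> :: "nat \<Rightarrow> nat \<Rightarrow> 'm \<Rightarrow> 'm"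
  assumes subspace_M: "subspace (M n)"
    and coface_linear: "i \<le> n + 1 \<Longrightarrow> linear_between scale (M n) (M (n + 1)) (\<delta> n i)"
    and codegeneracy_linear: "j \<le> n \<Longrightarrow> linear_between scale (M (n + 1)) (M n) (\<sigma> n j)"
    and coface_coface: "x \<in> M n \<Longrightarrow> i < j \<Longrightarrow> j \<le> n + 2 \<Longrightarrow>
      \<delta> (n + 1) j (\<delta> n i x) = \<delta> (n + 1) i (\<delta> n (j - 1) x)"
    and codegeneracy_codegeneracy: "x \<in> M (n + 2) \<Longrightarrow> i \<le> j \<Longrightarrow> j \<le> n \<Longrightarrow>
      \<sigma> n j (\<sigma> (n + 1) i x) = \<sigma> n i (\<sigma> (n + 1) (j + 1) x)"
    and codegeneracy_coface_less: "x \<in> M (n + 1) \<Longrightarrow> i < j \<Longrightarrow> j \<le> n + 1 \<Longrightarrow>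
      \<sigma> (n + 1) j (\<delta> (n + 1) i x) = \<delta> n i (\<sigma> n (j - 1) x)"
    and codegeneracy_coface_same: "x \<in> M n \<Longrightarrow> j \<le> n \<Longrightarrow> i = j \<or> i = j + 1 \<Longrightarrow>
      \<sigma> n j (\<delta> n i x) = x"
    and codegeneracy_coface_greater: "x \<in> M (n + 1) \<Longrightarrow> j + 1 < i \<Longrightarrow> i \<le> n + 2 \<Longrightarrow>
      \<sigma> (n + 1) j (\<delta> (n + 1) i x) = \<delta> n (i - 1) (\<sigma> n j x)"

locale cocyclic_module = cosimplicial_module scale M \<delta> \<sigma>
  for scale :: "'k::field \<Rightarrow> 'm::ab_group_add \<Rightarrow> 'm"
    and M :: "nat \<Rightarrow> 'm set"
    and \<delta> \<sigma> :: "nat \<Rightarrow> nat \<Rightarrow> 'm \<Rightarrow> 'm" +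
  fixes \<tau> :: "nat \<Rightarrow> 'm \<Rightarrow> 'm"
  assumes cyclic_linear: "linear_between scale (M n) (M n) (\<tau> n)"
    and cyclic_power: "x \<in> M n \<Longrightarrow> (\<tau> n ^^ (n + 1)) x = x"
    and coface_cyclic: "x \<in> M n \<Longrightarrow> 1 \<le> i \<Longrightarrow> i \<le> n + 1 \<Longrightarrow>
      \<delta> n i (\<tau> n x) = - \<tau> (n + 1) (\<delta> n (i - 1) x)"
    and coface_zero: "x \<in> M n \<Longrightarrow>
      \<delta> n 0 x = scale ((- 1) ^ (n + 1)) (\<tau> (n + 1) (\<delta> n (n + 1) x))"
    and codegeneracy_cyclic: "x \<in> M (n + 1) \<Longrightarrow> 1 \<le> i \<Longrightarrow> i \<le> n \<Longrightarrow>
      \<sigma> n i (\<tau> (n + 1) x) = - \<tau> n (\<sigma> n (i - 1) x)"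
    and codegeneracy_zero: "x \<in> M (n + 1) \<Longrightarrow>
      \<sigma> n 0 (\<tau> (n + 1) (\<tau> (n + 1) x)) = scale ((- 1) ^ n) (\<tau> n (\<sigma> n n x))"

end

theory Submission
  imports Defs
begin

text \<open>
  Every coface, codegeneracy and cyclic operator is, up to a sign, composition of a functional with a
  linear map of chains: a face \<open>F\<^sub>i\<close>, a degeneracy \<open>D\<^sub>j\<close> or the rotation \<open>R\<close>, which
  takes \<open>c \<otimes> a\<^sub>1 \<otimes> \<dots> \<otimes> a\<^sub>m\<close> to
  \<open>c\<^sup>\<psi> \<otimes> a\<^sub>2 \<otimes> \<dots> \<otimes> a\<^sub>m \<otimes> a\<^sub>1\<^sub>\<psi>\<close>. So the theorem follows from identities between chain maps.
  They hold on all chains, with one exception: \<open>R\<^sup>m\<close> is not the identity on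
  \<open>C \<otimes> A\<^sup>\<otimes>\<^sup>m\<close>. Instead \<open>R\<^sup>m\<close> moves \<open>C\<close> past all factors and flips it
  back to the front (\<open>full_rotation_flip_move\<close>), so the invariant cochains are exactly those that are
  fixed under composition with \<open>R\<^sup>m\<close> (\<open>invariant_iff\<close>), and on them the cyclic operator has the
  required order.

  Four relations with \<open>R\<close> carry the proof: \<open>R F\<^sub>i\<^sub>+\<^sub>1 = F\<^sub>i R\<close> (\<open>rotation_face\<close>),
  \<open>F\<^sub>0 = F\<^sub>n\<^sub>+\<^sub>1 R\<close> (\<open>face_zero_rotation\<close>), \<open>R D\<^sub>j\<^sub>+\<^sub>1 = D\<^sub>j R\<close>
  (\<open>rotation_degeneracy\<close>) and \<open>R R D\<^sub>0 = D\<^sub>n R\<close> (\<open>rotation_rotation_degeneracy\<close>).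
  The case \<open>i = 0\<close> of the first is the compatibility of \<open>\<psi>\<close> with the product of \<open>A\<close>, the last is its
  compatibility with the unit; the others only use that \<open>\<psi>\<close> is linear. Formally, these relations imply that faces and
  degeneracies commute with the full rotations, hence preserve invariance, and that the simplicial
  identities for \<open>F\<^sub>0\<close> follow from those for the other faces, except for \<open>F\<^sub>0 D\<^sub>0 = id\<close>, which is
  the compatibility with the unit once more. The other faces and the degeneracies only merge neighbouring letters or insert units, so their identities are identities between lists.

  What remains is multilinear algebra. A multilinear map of words induces a linear map on tensors
  (\<open>lift_linear\<close>, \<open>lift_pure\<close>), two linear maps that agree on pure tensors are equal
  (\<open>linear_map_eqI\<close>), and linear maps may be applied under the summation sign of the Sweedler-type notation
  (\<open>sweedler_linear_map\<close>). With these rules each relation is checked on pure tensors as on paper.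
\<close>

section \<open>Formal sums of words\<close>

lemma lookup_fscale [simp]: "Poly_Mapping.lookup (fscale r f) x = r * Poly_Mapping.lookup f x"
  by (simp add: fscale_def Poly_Mapping.map.rep_eq when_def)

interpretation formal: vector_space "fscale :: 'k::field \<Rightarrow> ('x \<Rightarrow>\<^sub>0 'k) \<Rightarrow> ('x \<Rightarrow>\<^sub>0 'k)"
  by unfold_locales (auto intro!: poly_mapping_eqI simp: lookup_add algebra_simps)

lemma fscale_single [simp]: "fscale r (Poly_Mapping.single x s) = Poly_Mapping.single x (r * s)"
  by (rule poly_mapping_eqI) (simp add: lookup_single when_def)

lemma sum_single_lookup:
  "(\<Sum>x\<in>Poly_Mapping.keys f. Poly_Mapping.single x (Poly_Mapping.lookup f x)) = f"
proof (rule poly_mapping_eqI)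
  fix y
  show "Poly_Mapping.lookup (\<Sum>x\<in>Poly_Mapping.keys f. Poly_Mapping.single x (Poly_Mapping.lookup f x)) y
    = Poly_Mapping.lookup f y"
    by (simp add: lookup_sum lookup_single when_def sum.delta in_keys_iff)
qed

definition extend :: "('x \<Rightarrow> 'y \<Rightarrow>\<^sub>0 'k::field) \<Rightarrow> ('x \<Rightarrow>\<^sub>0 'k) \<Rightarrow> ('y \<Rightarrow>\<^sub>0 'k)" where
  "extend h f = (\<Sum>x\<in>Poly_Mapping.keys f. fscale (Poly_Mapping.lookup f x) (h x))"

lemma extend_superset:
  assumes "finite S" "Poly_Mapping.keys f \<subseteq> S"
  shows "extend h f = (\<Sum>x\<in>S. fscale (Poly_Mapping.lookup f x) (h x))"
  unfolding extend_def
  by (rule sum.mono_neutral_left) (use assms in \<open>auto simp: in_keys_iff\<close>)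

lemma extend_hom:
  fixes h :: "'a \<Rightarrow> 'b \<Rightarrow>\<^sub>0 'c::field"
  shows "module_hom fscale fscale (extend h)"
proof unfold_locales
  fix f g :: "'a \<Rightarrow>\<^sub>0 'c"
  let ?S = "Poly_Mapping.keys f \<union> Poly_Mapping.keys g"
  have "extend h (f + g) = (\<Sum>x\<in>?S. fscale (Poly_Mapping.lookup (f + g) x) (h x))"
    using Poly_Mapping.keys_add[of f g] by (intro extend_superset) auto
  also have "\<dots> = extend h f + extend h g"
    by (simp add: extend_superset[of ?S] lookup_add formal.scale_left_distrib sum.distrib)
  finally show "extend h (f + g) = extend h f + extend h g" .
next
  fix r f
  have "extend h (fscale r f)
    = (\<Sum>x\<in>Poly_Mapping.keys f. fscale (Poly_Mapping.lookup (fscale r f) x) (h x))"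
    by (intro extend_superset) (auto simp: in_keys_iff)
  then show "extend h (fscale r f) = fscale r (extend h f)"
    by (simp add: extend_def formal.scale_sum_right)
qed

lemmas extend_add = module_hom.add[OF extend_hom]
lemmas extend_diff = module_hom.diff[OF extend_hom]

lemma extend_single [simp]: "extend h (Poly_Mapping.single x r) = fscale r (h x)"
  by (subst extend_superset[of "{x}"]) auto

lemma extend_hom_left: "module_hom fscale fscale (\<lambda>f. extend (\<lambda>x. extend (h x) g) f)"
  by (rule extend_hom)

lemma extend_hom_right: "module_hom fscale fscale (\<lambda>g. extend (\<lambda>x. extend (h x) g) f)"
  by unfold_locales
    (simp_all add: extend_def[of _ f] module_hom.add[OF extend_hom]
      module_hom.scale[OF extend_hom] formal.scale_right_distrib sum.distrib
      formal.scale_sum_right mult.commute)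

lemma fconcat_extend:
  "fconcat f g = extend (\<lambda>u. extend (\<lambda>v. Poly_Mapping.single (u @ v) 1) g) f"
  by (simp add: fconcat_def extend_def formal.scale_sum_right)

lemma fconcat_hom_left: "module_hom fscale fscale (\<lambda>f. fconcat f g)"
  unfolding fconcat_extend by (rule extend_hom_left)

lemma fconcat_hom_right: "module_hom fscale fscale (fconcat f)"
  unfolding fconcat_extend by (rule extend_hom_right)

lemma fconcat_single [simp]:
  "fconcat (Poly_Mapping.single u r) (Poly_Mapping.single v s) = Poly_Mapping.single (u @ v) (r * s)"
  by (simp add: fconcat_extend)


section \<open>Tensors as cosets\<close>

context tensor_words
begin

text \<open>Treating both kinds of letters at once leaves two families of multilinearity relations instead of four.\<close>

definition letter_sum :: "('a, 'c) letter \<Rightarrow> ('a, 'c) letter \<Rightarrow> ('a, 'c) letter \<Rightarrow> bool" where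
  "letter_sum x y z \<longleftrightarrow> (\<exists>a b. x = Alg a \<and> y = Alg b \<and> z = Alg (a + b))
     \<or> (\<exists>c d. x = Coalg c \<and> y = Coalg d \<and> z = Coalg (c + d))"

definition letter_scale :: "'k \<Rightarrow> ('a, 'c) letter \<Rightarrow> ('a, 'c) letter \<Rightarrow> bool" where
  "letter_scale r x z \<longleftrightarrow> (\<exists>a. x = Alg a \<and> z = Alg (sA r a)) \<or> (\<exists>c. x = Coalg c \<and> z = Coalg (sC r c))"

lemma letter_sum_kind: "letter_sum x y z \<Longrightarrow> kind_of x = kind_of z \<and> kind_of y = kind_of z"
  by (auto simp: letter_sum_def)

lemma letter_scale_kind: "letter_scale r x z \<Longrightarrow> kind_of x = kind_of z"
  by (auto simp: letter_scale_def)

lemma relations_letter: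
  "relations =
     {Poly_Mapping.single (u @ [z] @ v) 1 - Poly_Mapping.single (u @ [x] @ v) 1
        - Poly_Mapping.single (u @ [y] @ v) 1 | u v x y z. letter_sum x y z}
   \<union> {Poly_Mapping.single (u @ [z] @ v) 1 - Poly_Mapping.single (u @ [x] @ v) r
        | u v r x z. letter_scale r x z}"
  unfolding relations_def letter_sum_def letter_scale_def by (rule set_eqI) blast

lemma relations_cases [consumes 1, case_names sum scale]:
  assumes "f \<in> relations"
  obtains u v x y z where "letter_sum x y z"
      "f = Poly_Mapping.single (u @ [z] @ v) 1 - Poly_Mapping.single (u @ [x] @ v) 1
        - Poly_Mapping.single (u @ [y] @ v) 1"
    | u v r x z where "letter_scale r x z"
      "f = Poly_Mapping.single (u @ [z] @ v) 1 - Poly_Mapping.single (u @ [x] @ v) r"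
  using assms unfolding relations_letter by blast

lemma relation_sum: "letter_sum x y z \<Longrightarrow>
    Poly_Mapping.single (u @ [z] @ v) 1 - Poly_Mapping.single (u @ [x] @ v) 1
      - Poly_Mapping.single (u @ [y] @ v) 1 \<in> relations"
  unfolding relations_letter by blast

lemma relation_scale: "letter_scale r x z \<Longrightarrow>
    Poly_Mapping.single (u @ [z] @ v) 1 - Poly_Mapping.single (u @ [x] @ v) r \<in> relations"
  unfolding relations_letter by blast

lemma subspace_null: "formal.subspace null"
  unfolding null_def by (rule formal.subspace_span)

lemma relations_null: "relations \<subseteq> null"
  unfolding null_def by (rule formal.span_superset)

lemmas null_0 [simp] = formal.subspace_0[OF subspace_null]
lemmas null_add = formal.subspace_add[OF subspace_null]
lemmas null_diff = formal.subspace_diff[OF subspace_null]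
lemmas null_scale = formal.subspace_scale[OF subspace_null]

lemma hom_null:
  assumes "module_hom fscale fscale F" "\<And>f. f \<in> relations \<Longrightarrow> F f \<in> null" "f \<in> null"
  shows "F f \<in> null"
proof -
  have "null \<subseteq> F -` null"
    unfolding null_def
    by (rule formal.span_minimal)
      (use assms(2) module_hom.subspace_vimage[OF assms(1) subspace_null] in \<open>auto simp: null_def\<close>)
  then show ?thesis using assms(3) by auto
qed

lemma coset_eq_iff: "coset f = coset g \<longleftrightarrow> f - g \<in> null"
proof
  assume "coset f = coset g"
  moreover have "f \<in> coset f" by (simp add: coset_def)
  ultimately show "f - g \<in> null" by (simp add: coset_def)
next
  assume *: "f - g \<in> null"
  have "h - f \<in> null \<longleftrightarrow> h - g \<in> null" for h
    using null_add[of "h - f" "f - g"] null_diff[of "h - g" "f - g"] * by auto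
  then show "coset f = coset g" by (simp add: coset_def)
qed

lemma mem_coset [simp]: "f \<in> coset f"
  by (simp add: coset_def)

lemma mem_coset_iff: "g \<in> coset f \<longleftrightarrow> coset g = coset f"
  by (simp add: coset_eq_iff) (simp add: coset_def)

lemma tadd_coset: "tadd (coset f) (coset g) = coset (f + g)"
proof (rule set_eqI)
  fix h
  have "\<exists>f'\<in>coset f. \<exists>g'\<in>coset g. h - (f' + g') \<in> null" if "h - (f + g) \<in> null"
    using that mem_coset by blast
  moreover have "h - (f + g) \<in> null"
    if "f' - f \<in> null" "g' - g \<in> null" "h - (f' + g') \<in> null" for f' g'
    using null_add[OF that(3) null_add[OF that(1,2)]] by (simp add: algebra_simps)
  ultimately show "h \<in> tadd (coset f) (coset g) \<longleftrightarrow> h \<in> coset (f + g)"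
    unfolding tadd_def by (auto simp: coset_def)
qed

lemma tscale_coset: "tscale r (coset f) = coset (fscale r f)"
proof (rule set_eqI)
  fix h
  have "\<exists>f'\<in>coset f. h - fscale r f' \<in> null" if "h - fscale r f \<in> null"
    using that mem_coset by blast
  moreover have "h - fscale r f \<in> null"
    if "f' - f \<in> null" "h - fscale r f' \<in> null" for f'
    using null_add[OF that(2) null_scale[OF that(1), of r]] by (simp add: formal.scale_right_diff_distrib)
  ultimately show "h \<in> tscale r (coset f) \<longleftrightarrow> h \<in> coset (fscale r f)"
    unfolding tscale_def by (auto simp: coset_def)
qed

text \<open>A relation extended by a word on either side is again a relation, so the null sums form a two-sided
  ideal for concatenation. This is what makes \<open>\<otimes>\<close> well defined on cosets.\<close>

lemma fconcat_null_left: assumes "f \<in> null" shows "fconcat f g \<in> null"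
proof (rule hom_null[OF fconcat_hom_left _ assms])
  fix f :: "('a, 'c, 'k) formal" assume f: "f \<in> relations"
  have "fconcat f (Poly_Mapping.single w 1) \<in> relations" for w
    using f
  proof (cases rule: relations_cases)
    case (sum u v x y z)
    then show ?thesis using relation_sum[of x y z u "v @ w"]
      by (simp add: module_hom.diff[OF fconcat_hom_left])
  next
    case (scale u v r x z)
    then show ?thesis using relation_scale[of r x z u "v @ w"]
      by (simp add: module_hom.diff[OF fconcat_hom_left])
  qed
  then have "fscale r (fconcat f (Poly_Mapping.single w 1)) \<in> null" for r w
    using relations_null by (blast intro: null_scale)
  then have 1: "fconcat f (Poly_Mapping.single w r) \<in> null" for r w
    using module_hom.scale[OF fconcat_hom_right, of f r "Poly_Mapping.single w 1"]
    by simp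
  have "fconcat f g = (\<Sum>w\<in>Poly_Mapping.keys g. fconcat f (Poly_Mapping.single w (Poly_Mapping.lookup g w)))"
    by (subst sum_single_lookup[of g, symmetric], subst module_hom.sum[OF fconcat_hom_right]) simp
  then show "fconcat f g \<in> null"
    using 1 by (simp add: formal.subspace_sum[OF subspace_null])
qed

lemma fconcat_null_right: assumes "g \<in> null" shows "fconcat f g \<in> null"
proof (rule hom_null[OF fconcat_hom_right _ assms])
  fix g :: "('a, 'c, 'k) formal" assume g: "g \<in> relations"
  have "fconcat (Poly_Mapping.single w 1) g \<in> relations" for w
    using g
  proof (cases rule: relations_cases)
    case (sum u v x y z)
    then show ?thesis using relation_sum[of x y z "w @ u" v]
      by (simp add: module_hom.diff[OF fconcat_hom_right])
  next
    case (scale u v r x z)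
    then show ?thesis using relation_scale[of r x z "w @ u" v]
      by (simp add: module_hom.diff[OF fconcat_hom_right])
  qed
  then have "fscale r (fconcat (Poly_Mapping.single w 1) g) \<in> null" for r w
    using relations_null by (blast intro: null_scale)
  then have 1: "fconcat (Poly_Mapping.single w r) g \<in> null" for r w
    using module_hom.scale[OF fconcat_hom_left, of r "Poly_Mapping.single w 1" g]
    by simp
  have "fconcat f g = (\<Sum>w\<in>Poly_Mapping.keys f. fconcat (Poly_Mapping.single w (Poly_Mapping.lookup f w)) g)"
    by (subst sum_single_lookup[of f, symmetric], subst module_hom.sum[OF fconcat_hom_left]) simp
  then show "fconcat f g \<in> null"
    using 1 by (simp add: formal.subspace_sum[OF subspace_null])
qed

lemma tconcat_coset: "coset f \<otimes> coset g = coset (fconcat f g)"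
proof (rule set_eqI)
  fix h
  have "\<exists>f'\<in>coset f. \<exists>g'\<in>coset g. h - fconcat f' g' \<in> null" if "h - fconcat f g \<in> null"
    using that mem_coset by blast
  moreover have "h - fconcat f g \<in> null"
    if "f' - f \<in> null" "g' - g \<in> null" "h - fconcat f' g' \<in> null" for f' g'
  proof -
    have "fconcat f' g' - fconcat f g = fconcat (f' - f) g' + fconcat f (g' - g)"
      by (simp add: module_hom.diff[OF fconcat_hom_left] module_hom.diff[OF fconcat_hom_right])
    then have "fconcat f' g' - fconcat f g \<in> null"
      using that by (auto intro: null_add fconcat_null_left fconcat_null_right)
    from null_add[OF that(3) this] show ?thesis by simp
  qed
  ultimately show "h \<in> coset f \<otimes> coset g \<longleftrightarrow> h \<in> coset (fconcat f g)"
    unfolding tconcat_def by (auto simp: coset_def)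
qed

lemma pure_tensor_concat: "pure_tensor u \<otimes> pure_tensor v = pure_tensor (u @ v)"
  by (simp add: pure_tensor_def tconcat_coset)

lemma T_E:
  assumes "t \<in> T p"
  obtains f where "t = coset f" "Poly_Mapping.keys f \<subseteq> words p"
  using assms by (auto simp: T_def)

lemma T_I: "Poly_Mapping.keys f \<subseteq> words p \<Longrightarrow> coset f \<in> T p"
  unfolding T_def by (rule imageI) simp

lemma pure_in_T: "w \<in> words p \<Longrightarrow> pure_tensor w \<in> T p"
  unfolding pure_tensor_def by (rule T_I) simp

lemma T_add:
  assumes "s \<in> T p" "t \<in> T p" shows "tadd s t \<in> T p"
proof -
  obtain f g where fg: "s = coset f" "Poly_Mapping.keys f \<subseteq> words p"
      "t = coset g" "Poly_Mapping.keys g \<subseteq> words p"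
    using assms by (elim T_E)
  have "Poly_Mapping.keys (f + g) \<subseteq> words p"
    using fg by (intro order_trans[OF Poly_Mapping.keys_add]) simp
  then show ?thesis by (simp add: fg tadd_coset T_I)
qed

lemma T_scale:
  assumes "t \<in> T p" shows "tscale r t \<in> T p"
proof -
  obtain f where f: "t = coset f" "Poly_Mapping.keys f \<subseteq> words p"
    using assms by (elim T_E)
  then have "Poly_Mapping.keys (fscale r f) \<subseteq> words p" by (auto simp: in_keys_iff)
  then show ?thesis by (simp add: f tscale_coset T_I)
qed

lemma T_zero: "coset 0 \<in> T p"
  by (rule T_I) simp

lemma subspace_coset_T: "formal.subspace {f. coset f \<in> T p}"
  by (rule formal.subspaceI)
    (simp_all add: T_zero T_add T_scale tadd_coset[symmetric] tscale_coset[symmetric])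

lemma T_concat: assumes "s \<in> T p" "t \<in> T q" shows "s \<otimes> t \<in> T (p @ q)"
proof -
  obtain f g where fg: "s = coset f" "t = coset g"
      "Poly_Mapping.keys f \<subseteq> words p" "Poly_Mapping.keys g \<subseteq> words q"
    using assms by (elim T_E)
  have "coset (fscale r (Poly_Mapping.single (u @ v) 1)) \<in> T (p @ q)"
    if "u \<in> words p" "v \<in> words q" for u v r
    using that T_scale[OF pure_in_T[of "u @ v" "p @ q"], of r]
    by (simp add: words_def pure_tensor_def tscale_coset)
  then have "fconcat f g \<in> {f. coset f \<in> T (p @ q)}"
    unfolding fconcat_def using fg
    by (intro formal.subspace_sum[OF subspace_coset_T]) (auto simp: subset_iff)
  then show ?thesis by (simp add: fg tconcat_coset)
qed

text \<open>A tensor of shape \<open>p\<close> is a finite linear combination of pure tensors of that shape, so it can be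
  built up one term at a time.\<close>

lemma T_induct [consumes 1, case_names zero step]:
  assumes "t \<in> T p" "P (coset 0)"
    and step: "\<And>r w t. w \<in> words p \<Longrightarrow> t \<in> T p \<Longrightarrow> P t \<Longrightarrow> P (tadd (tscale r (pure_tensor w)) t)"
  shows "P t"
proof -
  obtain f where f: "t = coset f" "Poly_Mapping.keys f \<subseteq> words p"
    using assms(1) by (rule T_E)
  have "P (coset (\<Sum>w\<in>S. Poly_Mapping.single w (c w))) \<and> coset (\<Sum>w\<in>S. Poly_Mapping.single w (c w)) \<in> T p"
    if "finite S" "S \<subseteq> words p" for S c
    using that
  proof (induction S)
    case empty
    then show ?case using assms(2) T_zero by simp
  next
    case (insert w S)
    have "coset (\<Sum>w\<in>insert w S. Poly_Mapping.single w (c w))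
      = tadd (tscale (c w) (pure_tensor w)) (coset (\<Sum>w\<in>S. Poly_Mapping.single w (c w)))"
      using insert by (simp add: pure_tensor_def tscale_coset tadd_coset)
    then show ?case using insert by (auto intro!: step T_add T_scale pure_in_T)
  qed
  from this[of "Poly_Mapping.keys f" "Poly_Mapping.lookup f"] f show ?thesis
    by (simp add: sum_single_lookup)
qed


section \<open>Linear and multilinear maps\<close>

lemma linear_map_in: "linear_map p q F \<Longrightarrow> t \<in> T p \<Longrightarrow> F t \<in> T q"
  by (simp add: linear_map_def)

lemma tscale_0: "t \<in> T p \<Longrightarrow> tscale 0 t = coset 0"
  by (elim T_E) (simp add: tscale_coset)

lemma linear_map_0: "linear_map p q F \<Longrightarrow> F (coset 0) = coset 0"
  using T_zero tscale_0 unfolding linear_map_def by metis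

text \<open>The basic tool for identities between operators: pure tensors span, so only they have to be checked.\<close>

lemma linear_map_eqI:
  assumes "t \<in> T p" "linear_map p q F" "linear_map p q G"
    and "\<And>w. w \<in> words p \<Longrightarrow> F (pure_tensor w) = G (pure_tensor w)"
  shows "F t = G t"
  using assms(1)
proof (induction rule: T_induct)
  case zero
  then show ?case using assms(2,3) linear_map_0 by metis
next
  case (step r w t)
  then show ?case using assms(2-4) unfolding linear_map_def
    by (simp add: pure_in_T T_scale)
qed

lemma linear_map_id: "linear_map p p id" "linear_map p p (\<lambda>t. t)"
  by (simp_all add: linear_map_def)

lemma linear_map_comp:
  "linear_map p q F \<Longrightarrow> linear_map q r G \<Longrightarrow> linear_map p r (\<lambda>t. G (F t))"
  by (simp add: linear_map_def)

lemma linear_map_concat_left: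
  assumes "t \<in> T q"
  shows "linear_map p (p @ q) (\<lambda>s. s \<otimes> t)"
proof -
  obtain g where t: "t = coset g" using assms by (rule T_E)
  show ?thesis
    unfolding linear_map_def
  proof (intro conjI ballI allI)
    fix s assume "s \<in> T p" then show "s \<otimes> t \<in> T (p @ q)" by (rule T_concat[OF _ assms])
  next
    fix r s assume "r \<in> T p" "s \<in> T p"
    then show "tadd r s \<otimes> t = tadd (r \<otimes> t) (s \<otimes> t)"
      by (elim T_E) (simp add: t tadd_coset tconcat_coset module_hom.add[OF fconcat_hom_left])
  next
    fix r s assume "s \<in> T p"
    then show "tscale r s \<otimes> t = tscale r (s \<otimes> t)"
      by (elim T_E) (simp add: t tscale_coset tconcat_coset module_hom.scale[OF fconcat_hom_left])
  qed
qed

lemma linear_map_concat_right: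
  assumes "s \<in> T p"
  shows "linear_map q (p @ q) (\<lambda>t. s \<otimes> t)"
proof -
  obtain f where s: "s = coset f" using assms by (rule T_E)
  show ?thesis
    unfolding linear_map_def
  proof (intro conjI ballI allI)
    fix t assume "t \<in> T q" then show "s \<otimes> t \<in> T (p @ q)" by (rule T_concat[OF assms])
  next
    fix r t assume "r \<in> T q" "t \<in> T q"
    then show "s \<otimes> tadd r t = tadd (s \<otimes> r) (s \<otimes> t)"
      by (elim T_E) (simp add: s tadd_coset tconcat_coset module_hom.add[OF fconcat_hom_right])
  next
    fix r t assume "t \<in> T q"
    then show "s \<otimes> tscale r t = tscale r (s \<otimes> t)"
      by (elim T_E) (simp add: s tscale_coset tconcat_coset module_hom.scale[OF fconcat_hom_right])
  qed
qed

definition multilinear :: "kind list \<Rightarrow> kind list \<Rightarrow> (('a, 'c) letter list \<Rightarrow> ('a, 'c, 'k) tensor) \<Rightarrow> bool"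
  where "multilinear p q \<phi> \<longleftrightarrow>
    (\<forall>w\<in>words p. \<phi> w \<in> T q) \<and>
    (\<forall>u v x y z. letter_sum x y z \<longrightarrow> u @ [z] @ v \<in> words p \<longrightarrow>
       \<phi> (u @ [z] @ v) = tadd (\<phi> (u @ [x] @ v)) (\<phi> (u @ [y] @ v))) \<and>
    (\<forall>u v r x z. letter_scale r x z \<longrightarrow> u @ [z] @ v \<in> words p \<longrightarrow>
       \<phi> (u @ [z] @ v) = tscale r (\<phi> (u @ [x] @ v)))"

lemma multilinear_in: "multilinear p q \<phi> \<Longrightarrow> w \<in> words p \<Longrightarrow> \<phi> w \<in> T q"
  by (simp add: multilinear_def)

lemma letter_sum_words:
  "letter_sum x y z \<Longrightarrow> u @ [z] @ v \<in> words p \<Longrightarrow> u @ [x] @ v \<in> words p \<and> u @ [y] @ v \<in> words p"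
  using letter_sum_kind[of x y z] by (auto simp: words_def)

lemma letter_scale_words:
  "letter_scale r x z \<Longrightarrow> u @ [z] @ v \<in> words p \<Longrightarrow> u @ [x] @ v \<in> words p"
  using letter_scale_kind[of r x z] by (auto simp: words_def)

lemma multilinear_cong:
  assumes "multilinear p q \<phi>" "\<And>w. w \<in> words p \<Longrightarrow> \<phi> w = \<chi> w"
  shows "multilinear p q \<chi>"
  unfolding multilinear_def
proof (intro conjI allI impI ballI)
  fix w :: "('a, 'c) letter list" assume "w \<in> words p"
  then show "\<chi> w \<in> T q" using assms by (metis multilinear_in)
next
  fix u v x y z assume h: "letter_sum x y z" "u @ [z] @ v \<in> words p"
  then show "\<chi> (u @ [z] @ v) = tadd (\<chi> (u @ [x] @ v)) (\<chi> (u @ [y] @ v))"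
    using assms letter_sum_words[OF h] unfolding multilinear_def by metis
next
  fix u v r x z assume h: "letter_scale r x z" "u @ [z] @ v \<in> words p"
  then show "\<chi> (u @ [z] @ v) = tscale r (\<chi> (u @ [x] @ v))"
    using assms letter_scale_words[OF h] unfolding multilinear_def by metis
qed

lemma multilinear_linear_map:
  assumes "multilinear p q \<phi>" "linear_map q r F"
  shows "multilinear p r (\<lambda>w. F (\<phi> w))"
  unfolding multilinear_def
proof (intro conjI allI impI ballI)
  fix w :: "('a, 'c) letter list" assume "w \<in> words p"
  then show "F (\<phi> w) \<in> T r" using assms by (metis multilinear_in linear_map_in)
next
  fix u v x y z assume h: "letter_sum x y z" "u @ [z] @ v \<in> words p"
  then show "F (\<phi> (u @ [z] @ v)) = tadd (F (\<phi> (u @ [x] @ v))) (F (\<phi> (u @ [y] @ v)))"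
    using assms letter_sum_words[OF h] unfolding multilinear_def linear_map_def by metis
next
  fix u v k x z assume h: "letter_scale k x z" "u @ [z] @ v \<in> words p"
  then show "F (\<phi> (u @ [z] @ v)) = tscale k (F (\<phi> (u @ [x] @ v)))"
    using assms letter_scale_words[OF h] unfolding multilinear_def linear_map_def by metis
qed

lemma multilinear_pure: "multilinear p p pure_tensor"
  unfolding multilinear_def
proof (intro conjI allI impI ballI)
  fix w :: "('a, 'c) letter list" assume "w \<in> words p"
  then show "pure_tensor w \<in> T p" by (rule pure_in_T)
next
  fix u v x y z assume h: "letter_sum x y z"
  show "pure_tensor (u @ [z] @ v) = tadd (pure_tensor (u @ [x] @ v)) (pure_tensor (u @ [y] @ v))"
    using relation_sum[OF h, of u v] relations_null
    by (auto simp: pure_tensor_def tadd_coset coset_eq_iff diff_diff_eq)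
next
  fix u v r x z assume h: "letter_scale r x z"
  show "pure_tensor (u @ [z] @ v) = tscale r (pure_tensor (u @ [x] @ v))"
    using relation_scale[OF h, of u v] relations_null
    by (auto simp: pure_tensor_def tscale_coset coset_eq_iff)
qed

lemma linear_map_multilinear: "linear_map p q F \<Longrightarrow> multilinear p q (\<lambda>w. F (pure_tensor w))"
  by (rule multilinear_linear_map[OF multilinear_pure])

lemma words_append:
  fixes u v :: "('x, 'y) letter list"
  assumes "length u = length p"
  shows "u @ v \<in> words (p @ q) \<longleftrightarrow> u \<in> words p \<and> v \<in> words q"
  using assms by (auto simp: words_def)

lemma words_length: "w \<in> words p \<Longrightarrow> length w = length p"
  by (auto simp: words_def)

lemma words_appendI: "u \<in> words p \<Longrightarrow> v \<in> words q \<Longrightarrow> u @ v \<in> words (p @ q)"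
  by (auto simp: words_def)

lemma words_append_E:
  assumes "w \<in> words (p @ q)"
  obtains u v where "w = u @ v" "u \<in> words p" "v \<in> words q"
  using assms by (auto simp: words_def map_eq_append_conv)

lemma multilinear_context:
  assumes "multilinear (p @ q @ r) s \<phi>" "u \<in> words p" "v \<in> words r"
  shows "multilinear q s (\<lambda>w. \<phi> (u @ w @ v))"
  unfolding multilinear_def
proof (intro conjI allI impI ballI)
  fix w :: "('a, 'c) letter list" assume "w \<in> words q"
  then show "\<phi> (u @ w @ v) \<in> T s" using assms by (metis multilinear_in words_appendI)
next
  fix u' v' x y z assume h: "letter_sum x y z" "u' @ [z] @ v' \<in> words q"
  then have "(u @ u') @ [z] @ (v' @ v) \<in> words (p @ q @ r)"
    using assms words_appendI by (metis append.assoc)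
  with h assms(1) have "\<phi> ((u @ u') @ [z] @ (v' @ v))
    = tadd (\<phi> ((u @ u') @ [x] @ (v' @ v))) (\<phi> ((u @ u') @ [y] @ (v' @ v)))"
    unfolding multilinear_def by blast
  then show "\<phi> (u @ (u' @ [z] @ v') @ v)
    = tadd (\<phi> (u @ (u' @ [x] @ v') @ v)) (\<phi> (u @ (u' @ [y] @ v') @ v))" by simp
next
  fix u' v' k x z assume h: "letter_scale k x z" "u' @ [z] @ v' \<in> words q"
  then have "(u @ u') @ [z] @ (v' @ v) \<in> words (p @ q @ r)"
    using assms words_appendI by (metis append.assoc)
  with h assms(1) have "\<phi> ((u @ u') @ [z] @ (v' @ v)) = tscale k (\<phi> ((u @ u') @ [x] @ (v' @ v)))"
    unfolding multilinear_def by blast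
  then show "\<phi> (u @ (u' @ [z] @ v') @ v) = tscale k (\<phi> (u @ (u' @ [x] @ v') @ v))" by simp
qed

text \<open>The letter singled out in a word of shape \<open>p @ q\<close> belongs to one of the two parts. Hence
  multilinearity may be checked on each part with the other one fixed (\<open>multilinear_append\<close>).\<close>

lemma words_split_letter:
  assumes "u @ [z] @ v \<in> words (p @ q)"
  obtains v1 v2 where "v = v1 @ v2" "u @ [z] @ v1 \<in> words p" "v2 \<in> words q"
    | u1 u2 where "u = u1 @ u2" "u1 \<in> words p" "u2 @ [z] @ v \<in> words q"
proof (cases "length u < length p")
  case True
  let ?n = "length p - Suc (length u)"
  have "u @ [z] @ v = (u @ [z] @ take ?n v) @ drop ?n v" by simp
  moreover have "length (u @ [z] @ take ?n v) = length p"
    using True words_length[OF assms] by simp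
  ultimately have "u @ [z] @ take ?n v \<in> words p" "drop ?n v \<in> words q"
    using assms words_append by metis+
  then show ?thesis by (intro that(1)[of "take ?n v" "drop ?n v"]) simp_all
next
  case False
  let ?n = "length p"
  have "u @ [z] @ v = take ?n u @ (drop ?n u @ [z] @ v)" by (metis append_take_drop_id append.assoc)
  moreover have "length (take ?n u) = length p"
    using False by simp
  ultimately have "take ?n u \<in> words p" "drop ?n u @ [z] @ v \<in> words q"
    using assms words_append by metis+
  then show ?thesis by (intro that(2)[of "take ?n u" "drop ?n u"]) simp_all
qed

lemma multilinear_append:
  assumes left: "\<And>v. v \<in> words q \<Longrightarrow> multilinear p r (\<lambda>u. \<phi> (u @ v))"
    and right: "\<And>u. u \<in> words p \<Longrightarrow> multilinear q r (\<lambda>v. \<phi> (u @ v))"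
  shows "multilinear (p @ q) r \<phi>"
  unfolding multilinear_def
proof (intro conjI allI impI ballI)
  fix w :: "('a, 'c) letter list" assume "w \<in> words (p @ q)"
  then show "\<phi> w \<in> T r" by (elim words_append_E) (metis left multilinear_in)
next
  fix u v x y z assume h: "letter_sum x y z" and w: "u @ [z] @ v \<in> words (p @ q)"
  from w show "\<phi> (u @ [z] @ v) = tadd (\<phi> (u @ [x] @ v)) (\<phi> (u @ [y] @ v))"
  proof (cases rule: words_split_letter)
    case (1 v1 v2)
    then show ?thesis using left[OF 1(3)] h unfolding multilinear_def by simp
  next
    case (2 u1 u2)
    then show ?thesis using right[OF 2(2)] h unfolding multilinear_def by simp
  qed
next
  fix u v k x z assume h: "letter_scale k x z" and w: "u @ [z] @ v \<in> words (p @ q)"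
  from w show "\<phi> (u @ [z] @ v) = tscale k (\<phi> (u @ [x] @ v))"
  proof (cases rule: words_split_letter)
    case (1 v1 v2)
    then show ?thesis using left[OF 1(3)] h unfolding multilinear_def by simp
  next
    case (2 u1 u2)
    then show ?thesis using right[OF 2(2)] h unfolding multilinear_def by simp
  qed
qed

text \<open>The lift does not depend on the representative chosen by \<open>lift\<close>. Extending \<open>\<phi>\<close> by zero to words of other
  shapes makes it defined on all relations: those of shape \<open>p\<close> become null by
  multilinearity, and all others vanish because the words in a relation have a common shape.\<close>

lemma lift_coset:
  assumes "multilinear p q \<phi>" "Poly_Mapping.keys f \<subseteq> words p"
  shows "lift p \<phi> (coset f) = coset (extend (\<lambda>w. SOME h. h \<in> \<phi> w) f)"
proof -
  define rep where "rep w = (if w \<in> words p then SOME h. h \<in> \<phi> w else 0)" for w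
  have rep: "coset (rep w) = \<phi> w" if w: "w \<in> words p" for w
  proof -
    obtain g where g: "\<phi> w = coset g" using multilinear_in[OF assms(1) w] by (rule T_E)
    then have "\<phi> w \<noteq> {}" using mem_coset by blast
    then have "rep w \<in> \<phi> w" using w by (simp add: rep_def some_in_eq)
    then show ?thesis by (simp add: g mem_coset_iff)
  qed
  have outside: "rep w = 0" if "w \<notin> words p" for w using that by (simp add: rep_def)
  have restrict: "extend (\<lambda>w. SOME h. h \<in> \<phi> w) g = extend rep g"
    if "Poly_Mapping.keys g \<subseteq> words p" for g
    using that unfolding extend_def rep_def by (intro sum.cong) auto
  have null: "extend rep g \<in> null" if "g \<in> null" for g
  proof (rule hom_null[OF extend_hom _ that])
    fix g :: "('a, 'c, 'k) formal" assume "g \<in> relations"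
    then show "extend rep g \<in> null"
    proof (cases rule: relations_cases)
      case (sum u v x y z)
      show ?thesis
      proof (cases "u @ [z] @ v \<in> words p")
        case True
        note w = letter_sum_words[OF sum(1) True]
        have "\<phi> (u @ [z] @ v) = tadd (\<phi> (u @ [x] @ v)) (\<phi> (u @ [y] @ v))"
          using assms(1) sum(1) True unfolding multilinear_def by blast
        then have "coset (rep (u @ [z] @ v)) = coset (rep (u @ [x] @ v) + rep (u @ [y] @ v))"
          using rep w True by (metis tadd_coset)
        then show ?thesis unfolding sum(2) by (simp add: extend_diff extend_add coset_eq_iff diff_diff_eq)
      next
        case False
        then have "u @ [x] @ v \<notin> words p" "u @ [y] @ v \<notin> words p"
          using letter_sum_kind[OF sum(1)] by (auto simp: words_def)
        with False show ?thesis unfolding sum(2) by (simp add: extend_diff outside del: append_Cons)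
      qed
    next
      case (scale u v r x z)
      show ?thesis
      proof (cases "u @ [z] @ v \<in> words p")
        case True
        note w = letter_scale_words[OF scale(1) True]
        have "\<phi> (u @ [z] @ v) = tscale r (\<phi> (u @ [x] @ v))"
          using assms(1) scale(1) True unfolding multilinear_def by blast
        then have "coset (rep (u @ [z] @ v)) = coset (fscale r (rep (u @ [x] @ v)))"
          using rep w True by (metis tscale_coset)
        then show ?thesis unfolding scale(2) by (simp add: extend_diff coset_eq_iff)
      next
        case False
        then have "u @ [x] @ v \<notin> words p"
          using letter_scale_kind[OF scale(1)] by (auto simp: words_def)
        with False show ?thesis unfolding scale(2) by (simp add: extend_diff outside del: append_Cons)
      qed
    qed
  qed
  define g where "g = (SOME g. g \<in> coset f \<and> Poly_Mapping.keys g \<subseteq> words p)"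
  have "g \<in> coset f \<and> Poly_Mapping.keys g \<subseteq> words p"
    unfolding g_def by (rule someI[of _ f]) (simp add: assms(2))
  then have g: "g - f \<in> null" "Poly_Mapping.keys g \<subseteq> words p" by (auto simp: coset_def)
  have "lift p \<phi> (coset f) = coset (extend (\<lambda>w. SOME h. h \<in> \<phi> w) g)"
    unfolding lift_def extend_def Let_def g_def ..
  also have "\<dots> = coset (extend rep f)"
    using null[OF g(1)] by (simp add: restrict g(2) coset_eq_iff extend_diff)
  finally show ?thesis by (simp add: restrict assms(2))
qed

lemma lift_pure:
  assumes "multilinear p q \<phi>" "w \<in> words p"
  shows "lift p \<phi> (pure_tensor w) = \<phi> w"
proof -
  obtain g where g: "\<phi> w = coset g" using multilinear_in[OF assms] by (rule T_E)
  have "coset (SOME h. h \<in> coset g) = coset g"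
    using mem_coset[of g] by (intro mem_coset_iff[THEN iffD1] some_in_eq[THEN iffD2]) blast
  then have rep: "coset (SOME h. h \<in> \<phi> w) = \<phi> w" by (simp only: g)
  have "lift p \<phi> (pure_tensor w) = coset (extend (\<lambda>w. SOME h. h \<in> \<phi> w) (Poly_Mapping.single w 1))"
    unfolding pure_tensor_def by (rule lift_coset[OF assms(1)]) (simp add: assms(2))
  also have "\<dots> = coset (SOME h. h \<in> \<phi> w)" by (simp only: extend_single formal.scale_one)
  finally show ?thesis by (simp only: rep)
qed

lemma lift_linear:
  assumes "multilinear p q \<phi>"
  shows "linear_map p q (lift p \<phi>)"
  unfolding linear_map_def
proof (intro conjI ballI allI)
  fix t assume "t \<in> T p"
  then obtain f where f: "t = coset f" "Poly_Mapping.keys f \<subseteq> words p" by (rule T_E)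
  have "(SOME h. h \<in> \<phi> w) \<in> {f. coset f \<in> T q}" if w: "w \<in> words p" for w
  proof -
    have "lift p \<phi> (pure_tensor w) = coset (SOME h. h \<in> \<phi> w)"
      unfolding pure_tensor_def using w by (simp add: lift_coset[OF assms])
    then have "coset (SOME h. h \<in> \<phi> w) = \<phi> w"
      using lift_pure[OF assms w] by (rule trans[OF sym])
    then show ?thesis using multilinear_in[OF assms w] by (intro CollectI) (rule ssubst)
  qed
  then have "fscale r (SOME h. h \<in> \<phi> w) \<in> {f. coset f \<in> T q}"
    if "w \<in> Poly_Mapping.keys f" for r w
    using that f(2) by (intro formal.subspace_scale[OF subspace_coset_T]) blast
  then have "extend (\<lambda>w. SOME h. h \<in> \<phi> w) f \<in> {f. coset f \<in> T q}"
    unfolding extend_def by (rule formal.subspace_sum[OF subspace_coset_T])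
  then show "lift p \<phi> t \<in> T q" using f by (simp add: lift_coset[OF assms])
next
  fix s t assume "s \<in> T p" "t \<in> T p"
  then obtain f g where f: "s = coset f" "Poly_Mapping.keys f \<subseteq> words p"
    and g: "t = coset g" "Poly_Mapping.keys g \<subseteq> words p" by (elim T_E)
  have "Poly_Mapping.keys (f + g) \<subseteq> words p"
    using f g by (intro order_trans[OF Poly_Mapping.keys_add]) simp
  then show "lift p \<phi> (tadd s t) = tadd (lift p \<phi> s) (lift p \<phi> t)"
    using f g by (simp add: tadd_coset lift_coset[OF assms] extend_add)
next
  fix r t assume "t \<in> T p"
  then obtain f where f: "t = coset f" "Poly_Mapping.keys f \<subseteq> words p" by (rule T_E)
  have "Poly_Mapping.keys (fscale r f) \<subseteq> words p" using f by (auto simp: in_keys_iff)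
  then show "lift p \<phi> (tscale r t) = tscale r (lift p \<phi> t)"
    using f by (simp add: tscale_coset lift_coset[OF assms] module_hom.scale[OF extend_hom])
qed

lemma tensor_map_multilinear:
  assumes "linear_map p p' F" "linear_map q q' G"
  shows "multilinear (p @ q) (p' @ q')
    (\<lambda>w. F (pure_tensor (take (length p) w)) \<otimes> G (pure_tensor (drop (length p) w)))"
proof (rule multilinear_append)
  fix v :: "('a, 'c) letter list" assume v: "v \<in> words q"
  have "multilinear p (p' @ q') (\<lambda>u. F (pure_tensor u) \<otimes> G (pure_tensor v))"
    by (rule multilinear_linear_map[OF linear_map_multilinear[OF assms(1)] linear_map_concat_left])
      (rule linear_map_in[OF assms(2) pure_in_T[OF v]])
  then show "multilinear p (p' @ q') (\<lambda>u. F (pure_tensor (take (length p) (u @ v)))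
      \<otimes> G (pure_tensor (drop (length p) (u @ v))))"
    by (rule multilinear_cong) (simp add: words_length)
next
  fix u :: "('a, 'c) letter list" assume u: "u \<in> words p"
  have "multilinear q (p' @ q') (\<lambda>v. F (pure_tensor u) \<otimes> G (pure_tensor v))"
    by (rule multilinear_linear_map[OF linear_map_multilinear[OF assms(2)] linear_map_concat_right])
      (rule linear_map_in[OF assms(1) pure_in_T[OF u]])
  then show "multilinear q (p' @ q') (\<lambda>v. F (pure_tensor (take (length p) (u @ v)))
      \<otimes> G (pure_tensor (drop (length p) (u @ v))))"
    by (rule multilinear_cong) (simp add: words_length[OF u])
qed

lemma tensor_map_linear:
  "linear_map p p' F \<Longrightarrow> linear_map q q' G \<Longrightarrow> linear_map (p @ q) (p' @ q') (tensor_map p q F G)"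
  unfolding tensor_map_def by (rule lift_linear[OF tensor_map_multilinear])

lemma tensor_map_pure:
  assumes "linear_map p p' F" "linear_map q q' G" "u \<in> words p" "v \<in> words q"
  shows "tensor_map p q F G (pure_tensor (u @ v)) = F (pure_tensor u) \<otimes> G (pure_tensor v)"
  unfolding tensor_map_def
    lift_pure[OF tensor_map_multilinear[OF assms(1,2)] words_appendI[OF assms(3,4)]]
  by (simp add: words_length[OF assms(3)])


lemma tconcat_empty: assumes "t \<in> T p" shows "t \<otimes> pure_tensor [] = t"
proof -
  have "linear_map p p (\<lambda>t. t \<otimes> pure_tensor [])"
    using linear_map_concat_left[of "pure_tensor []" "[]" p] pure_in_T[of "[]" "[]"]
    by (simp add: words_def)
  from linear_map_eqI[OF assms this linear_map_id(2)] show ?thesis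
    by (simp add: pure_tensor_concat)
qed

text \<open>A map that changes only one block of letters is the tensor product of the map on this block with
  identities. In this way faces and degeneracies inherit multilinearity from the product and the unit.\<close>

lemma multilinear_local:
  assumes f: "multilinear q q' (\<lambda>w. pure_tensor (f w))"
  shows "multilinear (p @ q @ r) (p @ q' @ r) (\<lambda>w. pure_tensor
    (take (length p) w @ f (take (length q) (drop (length p) w)) @ drop (length p + length q) w))"
proof -
  let ?G = "tensor_map q r (lift q (\<lambda>w. pure_tensor (f w))) id"
  let ?F = "tensor_map p (q @ r) id ?G"
  have G: "linear_map (q @ r) (q' @ r) ?G"
    by (intro tensor_map_linear lift_linear f linear_map_id)
  have F: "linear_map (p @ q @ r) (p @ q' @ r) ?F"
    by (intro tensor_map_linear G linear_map_id)
  show ?thesis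
  proof (rule multilinear_cong[OF linear_map_multilinear[OF F]])
    fix w :: "('a, 'c) letter list" assume "w \<in> words (p @ q @ r)"
    then obtain u x v where w: "w = u @ x @ v" "u \<in> words p" "x \<in> words q" "v \<in> words r"
      by (elim words_append_E) blast
    then show "?F (pure_tensor w) = pure_tensor
      (take (length p) w @ f (take (length q) (drop (length p) w)) @ drop (length p + length q) w)"
      by (simp add: tensor_map_pure[OF linear_map_id(1) G] words_appendI lift_pure[OF f]
        tensor_map_pure[OF lift_linear[OF f] linear_map_id(1)] pure_tensor_concat words_length)
  qed
qed

definition block_swap :: "kind list \<Rightarrow> kind list \<Rightarrow> ('a, 'c, 'k) tensor \<Rightarrow> ('a, 'c, 'k) tensor" where
  "block_swap p q = lift (p @ q) (\<lambda>w. pure_tensor (drop (length p) w @ take (length p) w))"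

lemma block_swap_multilinear:
  "multilinear (p @ q) (q @ p) (\<lambda>w. pure_tensor (drop (length p) w @ take (length p) w))"
proof (rule multilinear_append)
  fix v :: "('a, 'c) letter list" assume "v \<in> words q"
  then have "multilinear p (q @ p) (\<lambda>u. pure_tensor (v @ u @ []))"
    by (intro multilinear_context[of q p "[]" "q @ p"]) (simp_all add: multilinear_pure words_def)
  then show "multilinear p (q @ p)
      (\<lambda>u. pure_tensor (drop (length p) (u @ v) @ take (length p) (u @ v)))"
    by (rule multilinear_cong) (simp add: words_length)
next
  fix u :: "('a, 'c) letter list" assume u: "u \<in> words p"
  then have "multilinear q (q @ p) (\<lambda>v. pure_tensor ([] @ v @ u))"
    by (intro multilinear_context[of "[]" q p "q @ p"]) (simp_all add: multilinear_pure words_def)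
  then show "multilinear q (q @ p)
      (\<lambda>v. pure_tensor (drop (length p) (u @ v) @ take (length p) (u @ v)))"
    by (rule multilinear_cong) (simp add: words_length[OF u])
qed

lemma block_swap_linear: "linear_map (p @ q) (q @ p) (block_swap p q)"
  unfolding block_swap_def by (rule lift_linear[OF block_swap_multilinear])

lemma block_swap_pure:
  "u \<in> words p \<Longrightarrow> v \<in> words q \<Longrightarrow> block_swap p q (pure_tensor (u @ v)) = pure_tensor (v @ u)"
  unfolding block_swap_def
  by (subst lift_pure[OF block_swap_multilinear]) (simp_all add: words_appendI words_length)

end


section \<open>Merging entries and inserting units in a list\<close>

definition merge_at :: "nat \<Rightarrow> 'a::times list \<Rightarrow> 'a list" where
  "merge_at i as = take i as @ [as ! i * as ! Suc i] @ drop (Suc (Suc i)) as"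

definition insert_one :: "nat \<Rightarrow> 'a::one list \<Rightarrow> 'a list" where
  "insert_one j as = take j as @ [1] @ drop j as"

lemma merge_0 [simp]: "merge_at 0 (a # b # as) = a * b # as"
  by (simp add: merge_at_def)

lemma merge_Suc [simp]: "merge_at (Suc i) (a # as) = a # merge_at i as"
  by (simp add: merge_at_def)

lemma insert_one_0 [simp]: "insert_one 0 as = 1 # as"
  by (simp add: insert_one_def)

lemma insert_one_Suc [simp]: "insert_one (Suc j) (a # as) = a # insert_one j as"
  by (simp add: insert_one_def)

lemma length_merge: "Suc i < length as \<Longrightarrow> length (merge_at i as) = length as - 1"
  by (simp add: merge_at_def)

lemma length_insert_one: "length (insert_one j as) = Suc (length as)"
  by (simp add: insert_one_def)

lemma merge_append: "Suc i < length as \<Longrightarrow> merge_at i (as @ bs) = merge_at i as @ bs"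
  by (simp add: merge_at_def nth_append)

lemma insert_one_append: "j \<le> length as \<Longrightarrow> insert_one j (as @ bs) = insert_one j as @ bs"
  by (simp add: insert_one_def)

lemma merge_last: "merge_at (length as) (as @ [a, b]) = as @ [a * b]"
  by (simp add: merge_at_def nth_append)

lemma merge_merge:
  fixes as :: "'a::semigroup_mult list"
  shows "i < j \<Longrightarrow> Suc j < length as \<Longrightarrow> merge_at i (merge_at j as) = merge_at (j - 1) (merge_at i as)"
proof (induction i arbitrary: j as)
  case 0
  then obtain k where "j = Suc k" by (cases j) auto
  moreover from 0 obtain a b c bs where "as = a # b # c # bs"
    by (cases as; cases "tl as"; cases "tl (tl as)") auto
  ultimately show ?case by (cases k) (auto simp: mult.assoc)
next
  case (Suc i)
  then obtain k where k: "j = Suc k" by (cases j) auto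
  moreover from Suc.prems obtain a bs where "as = a # bs" by (cases as) auto
  moreover have "k \<noteq> 0" using Suc.prems k by auto
  ultimately show ?case using Suc.IH[of k bs] Suc.prems by (cases k) auto
qed

lemma insert_one_insert_one:
  "i \<le> j \<Longrightarrow> j \<le> length as \<Longrightarrow> insert_one i (insert_one j as) = insert_one (Suc j) (insert_one i as)"
proof (induction i arbitrary: j as)
  case (Suc i)
  then show ?case by (cases j; cases as) auto
qed simp

lemma merge_insert_one_less:
  "Suc i < j \<Longrightarrow> j \<le> length as \<Longrightarrow> merge_at i (insert_one j as) = insert_one (j - 1) (merge_at i as)"
proof (induction i arbitrary: j as)
  case 0
  then obtain k where "j = Suc (Suc k)" by (cases j; cases "j - 1") auto
  moreover from 0 this obtain a b bs where "as = a # b # bs" by (cases as; cases "tl as") auto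
  ultimately show ?case by simp
next
  case (Suc i)
  then obtain k where "j = Suc (Suc k)" by (cases j; cases "j - 1") auto
  with Suc show ?case by (cases as) auto
qed

lemma merge_insert_one_right:
  fixes as :: "'a::monoid_mult list"
  shows "j < length as \<Longrightarrow> merge_at j (insert_one j as) = as"
proof (induction j arbitrary: as)
  case 0
  then show ?case by (cases as) auto
next
  case (Suc j)
  then show ?case by (cases as) auto
qed

lemma merge_insert_one_left:
  fixes as :: "'a::monoid_mult list"
  shows "j < length as \<Longrightarrow> merge_at j (insert_one (Suc j) as) = as"
proof (induction j arbitrary: as)
  case 0
  then show ?case by (cases as) auto
next
  case (Suc j)
  then show ?case by (cases as) auto
qed

lemma merge_insert_one_greater:
  "j \<le> i \<Longrightarrow> Suc i < length as \<Longrightarrow> merge_at (Suc i) (insert_one j as) = insert_one j (merge_at i as)"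
proof (induction j arbitrary: i as)
  case (Suc j)
  then show ?case by (cases i; cases as) auto
qed simp


section \<open>Moving a coalgebra element past an algebra element\<close>

context entwining_structure
begin

lemma words_AC: "w \<in> words [Algebra, Coalgebra] \<longleftrightarrow> (\<exists>a c. w = [Alg a, Coalg c])"
proof
  assume "w \<in> words [Algebra, Coalgebra]"
  then obtain x y where "w = [x, y]" "kind_of x = Algebra" "kind_of y = Coalgebra"
    by (auto simp: words_def map_eq_Cons_conv)
  then show "\<exists>a c. w = [Alg a, Coalg c]" by (cases x; cases y) auto
qed (auto simp: words_def)

lemma words_CoA: "w \<in> words [Coalgebra, Algebra] \<longleftrightarrow> (\<exists>c a. w = [Coalg c, Alg a])"
proof
  assume "w \<in> words [Coalgebra, Algebra]"
  then obtain x y where "w = [x, y]" "kind_of x = Coalgebra" "kind_of y = Algebra"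
    by (auto simp: words_def map_eq_Cons_conv)
  then show "\<exists>c a. w = [Coalg c, Alg a]" by (cases x; cases y) auto
qed (auto simp: words_def)

lemma words_Algebra: "w \<in> words (replicate m Algebra) \<longleftrightarrow> (\<exists>as. w = map Alg as \<and> length as = m)"
proof (induction m arbitrary: w)
  case 0
  then show ?case by (auto simp: words_def)
next
  case (Suc m)
  have "w \<in> words (replicate (Suc m) Algebra)
    \<longleftrightarrow> (\<exists>a v. w = Alg a # v \<and> v \<in> words (replicate m Algebra))"
  proof
    assume "w \<in> words (replicate (Suc m) Algebra)"
    then obtain x v where "w = x # v" "kind_of x = Algebra" "v \<in> words (replicate m Algebra)"
      by (auto simp: words_def map_eq_Cons_conv)
    then show "\<exists>a v. w = Alg a # v \<and> v \<in> words (replicate m Algebra)" by (cases x) auto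
  qed (auto simp: words_def)
  also have "\<dots> \<longleftrightarrow> (\<exists>as. w = map Alg as \<and> length as = Suc m)"
    unfolding Suc.IH by (auto simp: length_Suc_conv intro: exI[of _ "_ # _"])
  finally show ?case .
qed

lemma words_CA: "w \<in> words (CA m) \<longleftrightarrow> (\<exists>c as. w = word c as \<and> length as = m)"
proof
  assume "w \<in> words (CA m)"
  then obtain x v where w: "w = x # v" "kind_of x = Coalgebra" "v \<in> words (replicate m Algebra)"
    by (auto simp: words_def CA_def map_eq_Cons_conv)
  then show "\<exists>c as. w = word c as \<and> length as = m"
    unfolding words_Algebra word_def by (cases x) auto
next
  assume "\<exists>c as. w = word c as \<and> length as = m"
  then obtain c as where w: "w = word c as" "length as = m" by blast
  then have "map Alg as \<in> words (replicate m Algebra)" by (auto simp: words_Algebra)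
  with w show "w \<in> words (CA m)" by (simp add: words_def CA_def word_def)
qed

lemma word_in_T: "length as = m \<Longrightarrow> pure_tensor (word c as) \<in> T (CA m)"
  by (rule pure_in_T) (auto simp: words_CA)

lemma CA_eqI:
  assumes "t \<in> T (CA m)" "linear_map (CA m) q F" "linear_map (CA m) q G"
    and "\<And>c as. length as = m \<Longrightarrow> F (pure_tensor (word c as)) = G (pure_tensor (word c as))"
  shows "F t = G t"
  using assms(1-3) by (rule linear_map_eqI) (use assms(4) in \<open>auto simp: words_CA\<close>)

lemma psi_in: "\<psi> (pure_tensor [Coalg c, Alg a]) \<in> T [Algebra, Coalgebra]"
  by (rule linear_map_in[OF entwining_linear]) (auto intro: pure_in_T simp: words_CoA)

definition bilinear :: "kind list \<Rightarrow> ('a \<Rightarrow> 'c \<Rightarrow> ('a, 'c, 'k) tensor) \<Rightarrow> bool" where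
  "bilinear q B \<longleftrightarrow> multilinear [Algebra, Coalgebra] q (\<lambda>w. B (alg (w ! 0)) (coalg (w ! 1)))"

text \<open>For a bilinear \<open>B\<close>, the map that defines \<open>sweedler\<close> is the linear map on \<open>A \<otimes> C\<close> induced by \<open>B\<close>.\<close>

lemma bilinear_lift:
  assumes "bilinear q B"
  shows "linear_map [Algebra, Coalgebra] q (lift [Algebra, Coalgebra] (\<lambda>w. B (alg (w ! 0)) (coalg (w ! 1))))"
    and "lift [Algebra, Coalgebra] (\<lambda>w. B (alg (w ! 0)) (coalg (w ! 1))) (pure_tensor [Alg a, Coalg c]) = B a c"
proof -
  note B = assms[unfolded bilinear_def]
  show "linear_map [Algebra, Coalgebra] q (lift [Algebra, Coalgebra] (\<lambda>w. B (alg (w ! 0)) (coalg (w ! 1))))"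
    by (rule lift_linear[OF B])
  have "[Alg a, Coalg c] \<in> words [Algebra, Coalgebra]" by (simp add: words_AC)
  from lift_pure[OF B this]
  show "lift [Algebra, Coalgebra] (\<lambda>w. B (alg (w ! 0)) (coalg (w ! 1))) (pure_tensor [Alg a, Coalg c]) = B a c"
    by simp
qed

text \<open>The way to bring a concrete linear map into Sweedler-type notation: on
  \<open>\<psi>(c \<otimes> a) \<in> A \<otimes> C\<close> it is determined by its values on pure tensors.\<close>

lemma linear_on_psi:
  assumes "linear_map [Algebra, Coalgebra] q G"
    and "\<And>a c. G (pure_tensor [Alg a, Coalg c]) = B a c"
  shows "bilinear q B" and "G (\<psi> (pure_tensor [Coalg c, Alg a])) = sweedler c a B"
proof -
  show B: "bilinear q B"
    unfolding bilinear_def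
    by (rule multilinear_cong[OF linear_map_multilinear[OF assms(1)]]) (auto simp: words_AC assms(2))
  show "G (\<psi> (pure_tensor [Coalg c, Alg a])) = sweedler c a B"
    unfolding sweedler_def
  proof (rule linear_map_eqI[OF psi_in assms(1) bilinear_lift(1)[OF B]])
    fix w :: "('a, 'c) letter list" assume "w \<in> words [Algebra, Coalgebra]"
    then obtain a c where "w = [Alg a, Coalg c]" by (auto simp: words_AC)
    then show "G (pure_tensor w)
        = lift [Algebra, Coalgebra] (\<lambda>w. B (alg (w ! 0)) (coalg (w ! 1))) (pure_tensor w)"
      by (simp only: bilinear_lift(2)[OF B] assms(2))
  qed
qed

text \<open>Linear maps may be applied under the summation sign, since both sides are values at
  \<open>\<psi>(c \<otimes> a)\<close> of linear maps that agree on pure tensors.\<close>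

lemma sweedler_linear_map:
  assumes "bilinear q B" "linear_map q r F"
  shows "F (sweedler c a B) = sweedler c a (\<lambda>a' c'. F (B a' c'))"
proof -
  have "F (lift [Algebra, Coalgebra] (\<lambda>w. B (alg (w ! 0)) (coalg (w ! 1))) (pure_tensor [Alg a', Coalg c']))
    = F (B a' c')" for a' c'
    by (simp only: bilinear_lift(2)[OF assms(1)])
  from linear_on_psi(2)[OF linear_map_comp[OF bilinear_lift(1)[OF assms(1)] assms(2)] this] show ?thesis
    unfolding sweedler_def .
qed

lemma bilinear_context:
  assumes "multilinear ([Algebra, Coalgebra] @ s) q \<phi>" "v \<in> words s"
  shows "bilinear q (\<lambda>a c. \<phi> (Alg a # Coalg c # v))"
proof -
  have "multilinear [Algebra, Coalgebra] q (\<lambda>w. \<phi> ([] @ w @ v))"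
    by (rule multilinear_context[where p="[]" and r=s]) (use assms in \<open>simp_all add: words_def\<close>)
  then show ?thesis unfolding bilinear_def by (rule multilinear_cong) (auto simp: words_AC)
qed

text \<open>The expression is the linear map induced by \<open>\<phi>\<close> after \<open>\<psi> \<otimes> id\<close>, hence multilinear in \<open>c\<close>, \<open>a\<close> and all
  further letters together.\<close>

lemma sweedler_multilinear:
  assumes "multilinear ([Algebra, Coalgebra] @ s) q \<phi>"
  shows "multilinear ([Coalgebra, Algebra] @ s) q
    (\<lambda>w. sweedler (coalg (w ! 0)) (alg (w ! 1)) (\<lambda>a c. \<phi> (Alg a # Coalg c # drop 2 w)))"
proof (rule multilinear_cong)
  let ?F = "\<lambda>t. lift ([Algebra, Coalgebra] @ s) \<phi> (tensor_map [Coalgebra, Algebra] s \<psi> id t)"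
  show "multilinear ([Coalgebra, Algebra] @ s) q (\<lambda>w. ?F (pure_tensor w))"
    by (intro linear_map_multilinear linear_map_comp[OF tensor_map_linear lift_linear[OF assms]]
        entwining_linear linear_map_id)
  fix w :: "('a, 'c) letter list" assume "w \<in> words ([Coalgebra, Algebra] @ s)"
  then obtain c a v where w: "w = [Coalg c, Alg a] @ v" "v \<in> words s"
    by (elim words_append_E) (auto simp: words_CoA)
  let ?G = "\<lambda>t. lift ([Algebra, Coalgebra] @ s) \<phi> (t \<otimes> pure_tensor v)"
  have "linear_map [Algebra, Coalgebra] q ?G"
    by (rule linear_map_comp[OF linear_map_concat_left[OF pure_in_T[OF w(2)]] lift_linear[OF assms]])
  moreover have "?G (pure_tensor [Alg a, Coalg c]) = \<phi> (Alg a # Coalg c # v)" for a c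
    using lift_pure[OF assms words_appendI[OF _ w(2), of "[Alg a, Coalg c]"]]
    by (simp add: pure_tensor_concat words_AC)
  ultimately have "?G (\<psi> (pure_tensor [Coalg c, Alg a])) = sweedler c a (\<lambda>a c. \<phi> (Alg a # Coalg c # v))"
    by (rule linear_on_psi(2))
  moreover have "tensor_map [Coalgebra, Algebra] s \<psi> id (pure_tensor w)
      = \<psi> (pure_tensor [Coalg c, Alg a]) \<otimes> pure_tensor v"
    unfolding w(1) using w(2)
    by (subst tensor_map_pure[OF entwining_linear linear_map_id(1)]) (auto simp: words_CoA)
  ultimately show "?F (pure_tensor w)
    = sweedler (coalg (w ! 0)) (alg (w ! 1)) (\<lambda>a c. \<phi> (Alg a # Coalg c # drop 2 w))"
    by (simp add: w(1))
qed

lemma sweedler_one: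
  assumes "bilinear q B" shows "sweedler c 1 B = B 1 c"
  unfolding sweedler_def entwining_unit by (rule bilinear_lift(2)[OF assms])

lemma multilinear_single:
  assumes "\<And>a. h a \<in> T q" "\<And>a b. h (a + b) = tadd (h a) (h b)" "\<And>r a. h (sA r a) = tscale r (h a)"
  shows "multilinear [Algebra] q (\<lambda>w. h (alg (w ! 0)))"
  unfolding multilinear_def
proof (intro conjI allI impI ballI)
  fix u v x y z assume "letter_sum x y z" "u @ [z] @ v \<in> words [Algebra]"
  moreover from this have "u = []" "v = []" by (auto dest!: words_length)
  ultimately show "h (alg ((u @ [z] @ v) ! 0)) = tadd (h (alg ((u @ [x] @ v) ! 0))) (h (alg ((u @ [y] @ v) ! 0)))"
    using assms(2) by (auto simp: letter_sum_def words_def)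
next
  fix u v r x z assume "letter_scale r x z" "u @ [z] @ v \<in> words [Algebra]"
  moreover from this have "u = []" "v = []" by (auto dest!: words_length)
  ultimately show "h (alg ((u @ [z] @ v) ! 0)) = tscale r (h (alg ((u @ [x] @ v) ! 0)))"
    using assms(3) by (auto simp: letter_scale_def words_def)
qed (rule assms(1))

lemma pure_Alg_in: "pure_tensor [Alg a] \<in> T [Algebra]"
  by (rule pure_in_T) (simp add: words_def)

lemma pure_Alg_add: "pure_tensor [Alg (a + b)] = tadd (pure_tensor [Alg a]) (pure_tensor [Alg b])"
proof -
  have "letter_sum (Alg a) (Alg b) (Alg (a + b))" by (simp add: letter_sum_def)
  moreover have "[] @ [Alg (a + b)] @ [] \<in> words [Algebra]" by (simp add: words_def)
  ultimately have "pure_tensor ([] @ [Alg (a + b)] @ [])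
    = tadd (pure_tensor ([] @ [Alg a] @ [])) (pure_tensor ([] @ [Alg b] @ []))"
    using multilinear_pure[of "[Algebra]"] unfolding multilinear_def by blast
  then show ?thesis by simp
qed

lemma pure_Alg_scale: "pure_tensor [Alg (sA r a)] = tscale r (pure_tensor [Alg a])"
proof -
  have "letter_scale r (Alg a) (Alg (sA r a))" by (simp add: letter_scale_def)
  moreover have "[] @ [Alg (sA r a)] @ [] \<in> words [Algebra]" by (simp add: words_def)
  ultimately have "pure_tensor ([] @ [Alg (sA r a)] @ []) = tscale r (pure_tensor ([] @ [Alg a] @ []))"
    using multilinear_pure[of "[Algebra]"] unfolding multilinear_def by blast
  then show ?thesis by simp
qed

lemma words_A: "w \<in> words [Algebra] \<longleftrightarrow> (\<exists>a. w = [Alg a])"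
  using words_Algebra[of w 1] by (simp add: length_Suc_conv) (metis list.simps(8,9))

lemma words_AA: "w \<in> words [Algebra, Algebra] \<longleftrightarrow> (\<exists>a b. w = [Alg a, Alg b])"
  using words_Algebra[of w 2] by (simp add: length_Suc_conv numeral_2_eq_2) (metis list.simps(8,9))

lemma product_multilinear:
  "multilinear [Algebra, Algebra] [Algebra] (\<lambda>w. pure_tensor [Alg (alg (w ! 0) * alg (w ! 1))])"
proof -
  have "multilinear ([Algebra] @ [Algebra]) [Algebra] (\<lambda>w. pure_tensor [Alg (alg (w ! 0) * alg (w ! 1))])"
  proof (rule multilinear_append)
    fix v :: "('a, 'c) letter list" assume "v \<in> words [Algebra]"
    then obtain b where v: "v = [Alg b]" by (auto simp: words_A)
    have "multilinear [Algebra] [Algebra] (\<lambda>u. pure_tensor [Alg (alg (u ! 0) * b)])"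
      by (rule multilinear_single)
        (simp_all add: pure_Alg_in distrib_right pure_Alg_add scale_mult_left pure_Alg_scale)
    then show "multilinear [Algebra] [Algebra] (\<lambda>u. pure_tensor [Alg (alg ((u @ v) ! 0) * alg ((u @ v) ! 1))])"
      by (rule multilinear_cong) (auto simp: words_A v)
  next
    fix u :: "('a, 'c) letter list" assume "u \<in> words [Algebra]"
    then obtain a where u: "u = [Alg a]" by (auto simp: words_A)
    have "multilinear [Algebra] [Algebra] (\<lambda>v. pure_tensor [Alg (a * alg (v ! 0))])"
      by (rule multilinear_single)
        (simp_all add: pure_Alg_in distrib_left pure_Alg_add scale_mult_right pure_Alg_scale)
    then show "multilinear [Algebra] [Algebra] (\<lambda>v. pure_tensor [Alg (alg ((u @ v) ! 0) * alg ((u @ v) ! 1))])"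
      by (rule multilinear_cong) (auto simp: words_A u)
  qed
  then show ?thesis by simp
qed

lemma product_map_linear: "linear_map [Algebra, Algebra] [Algebra] product_map"
  unfolding product_map_def by (rule lift_linear[OF product_multilinear])

lemma product_map_pure: "product_map (pure_tensor [Alg a, Alg b]) = pure_tensor [Alg (a * b)]"
  unfolding product_map_def by (subst lift_pure[OF product_multilinear]) (auto simp: words_AA)

text \<open>The axiom \<open>\<psi> \<circ> (id \<otimes> \<theta>) = (\<theta> \<otimes> id) \<circ> (id \<otimes> \<psi>) \<circ> (\<psi> \<otimes> id)\<close> in elementwise form. By linearity
  \<open>\<psi>(c \<otimes> a)\<close> may be replaced by a pure tensor \<open>a' \<otimes> c'\<close>, and then \<open>\<psi>(c' \<otimes> b)\<close> by
  \<open>b' \<otimes> c''\<close>.\<close>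

lemma sweedler_mult:
  assumes "bilinear q B"
  shows "sweedler c (a * b) B = sweedler c a (\<lambda>a' c'. sweedler c' b (\<lambda>b' c''. B (a' * b') c''))"
proof -
  let ?L = "lift [Algebra, Coalgebra] (\<lambda>w. B (alg (w ! 0)) (coalg (w ! 1)))"
  let ?\<mu> = "tensor_map [Algebra, Algebra] [Coalgebra] product_map id"
  let ?\<psi>2 = "tensor_map [Algebra] [Coalgebra, Algebra] id \<psi>"
  let ?\<psi>1 = "tensor_map [Coalgebra, Algebra] [Algebra] \<psi> id"
  have L: "linear_map [Algebra, Coalgebra] q ?L" by (rule bilinear_lift(1)[OF assms])
  have \<mu>: "linear_map [Algebra, Algebra, Coalgebra] [Algebra, Coalgebra] ?\<mu>"
    using tensor_map_linear[OF product_map_linear linear_map_id(1)[of "[Coalgebra]"]] by simp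
  have \<psi>2: "linear_map [Algebra, Coalgebra, Algebra] [Algebra, Algebra, Coalgebra] ?\<psi>2"
    using tensor_map_linear[OF linear_map_id(1)[of "[Algebra]"] entwining_linear] by simp
  have b: "linear_map [Algebra, Coalgebra] [Algebra, Coalgebra, Algebra] (\<lambda>t. t \<otimes> pure_tensor [Alg b])"
    using linear_map_concat_left[OF pure_Alg_in, of "[Algebra, Coalgebra]"] by simp
  have "pure_tensor [Coalg c, Alg a, Alg b] \<in> T [Coalgebra, Algebra, Algebra]"
    by (rule pure_in_T) (simp add: words_def)
  moreover have "tensor_map [Coalgebra] [Algebra, Algebra] id product_map (pure_tensor [Coalg c, Alg a, Alg b])
    = pure_tensor [Coalg c, Alg (a * b)]"
    using tensor_map_pure[OF linear_map_id(1) product_map_linear, of "[Coalg c]" "[Coalgebra]" "[Alg a, Alg b]"]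
    by (simp add: words_def product_map_pure pure_tensor_concat)
  moreover have "?\<psi>1 (pure_tensor [Coalg c, Alg a, Alg b]) = \<psi> (pure_tensor [Coalg c, Alg a]) \<otimes> pure_tensor [Alg b]"
    using tensor_map_pure[OF entwining_linear linear_map_id(1), of "[Coalg c, Alg a]" "[Alg b]" "[Algebra]"]
    by (simp add: words_def)
  ultimately have "sweedler c (a * b) B
    = ?L (?\<mu> (?\<psi>2 (\<psi> (pure_tensor [Coalg c, Alg a]) \<otimes> pure_tensor [Alg b])))"
    using entwining_product[of "pure_tensor [Coalg c, Alg a, Alg b]"] by (simp add: sweedler_def)
  also have "\<dots> = sweedler c a (\<lambda>a' c'. sweedler c' b (\<lambda>b' c''. B (a' * b') c''))"
  proof (rule linear_on_psi(2)[OF linear_map_comp[OF linear_map_comp[OF linear_map_comp[OF b \<psi>2] \<mu>] L]])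
    fix a' c'
    have a': "linear_map [Algebra, Coalgebra] [Algebra, Algebra, Coalgebra] (\<lambda>s. pure_tensor [Alg a'] \<otimes> s)"
      using linear_map_concat_right[OF pure_Alg_in, of "[Algebra, Coalgebra]"] by simp
    have "?\<psi>2 (pure_tensor [Alg a', Coalg c'] \<otimes> pure_tensor [Alg b])
      = pure_tensor [Alg a'] \<otimes> \<psi> (pure_tensor [Coalg c', Alg b])"
      using tensor_map_pure[OF linear_map_id(1) entwining_linear, of "[Alg a']" "[Algebra]" "[Coalg c', Alg b]"]
      by (simp add: words_def pure_tensor_concat)
    moreover have "?L (?\<mu> (pure_tensor [Alg a'] \<otimes> \<psi> (pure_tensor [Coalg c', Alg b])))
      = sweedler c' b (\<lambda>b' c''. B (a' * b') c'')"
    proof (rule linear_on_psi(2)[OF linear_map_comp[OF linear_map_comp[OF a' \<mu>] L]])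
      fix b' c''
      have "?\<mu> (pure_tensor [Alg a', Alg b', Coalg c'']) = pure_tensor [Alg (a' * b'), Coalg c'']"
        using tensor_map_pure[OF product_map_linear linear_map_id(1), of "[Alg a', Alg b']" "[Coalg c'']" "[Coalgebra]"]
        by (simp add: words_def product_map_pure pure_tensor_concat)
      then show "?L (?\<mu> (pure_tensor [Alg a'] \<otimes> pure_tensor [Alg b', Coalg c''])) = B (a' * b') c''"
        by (simp only: pure_tensor_concat append_Cons append_Nil bilinear_lift(2)[OF assms])
    qed
    ultimately show "?L (?\<mu> (?\<psi>2 (pure_tensor [Alg a', Coalg c'] \<otimes> pure_tensor [Alg b])))
      = sweedler c' b (\<lambda>b' c''. B (a' * b') c'')" by simp
  qed
  finally show ?thesis .
qed


section \<open>The operators on chains\<close>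

lemma map_Alg_words: "length as = m \<Longrightarrow> map Alg as \<in> words (replicate m Algebra)"
  by (auto simp: words_Algebra)

lemma word_words: "length as = m \<Longrightarrow> word c as \<in> words (CA m)"
  by (auto simp: words_CA)

lemma word_simps: "coalg (hd (word c as)) = c" "map alg (tl (word c as)) = as"
  by (simp_all add: word_def comp_def)

lemma rotated_multilinear:
  "multilinear ([Algebra, Coalgebra] @ replicate n Algebra) (CA (Suc n)) (\<lambda>w. pure_tensor (rotate1 w))"
proof -
  have "multilinear ([Algebra] @ CA n) (CA n @ [Algebra])
      (\<lambda>w. pure_tensor (drop (length [Algebra]) w @ take (length [Algebra]) w))"
    by (rule block_swap_multilinear)
  moreover have "[Algebra] @ CA n = [Algebra, Coalgebra] @ replicate n Algebra"
      and "CA n @ [Algebra] = CA (Suc n)"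
    by (simp_all add: CA_def replicate_append_same)
  ultimately have "multilinear ([Algebra, Coalgebra] @ replicate n Algebra) (CA (Suc n))
      (\<lambda>w. pure_tensor (drop (length [Algebra]) w @ take (length [Algebra]) w))" by simp
  then show ?thesis
  proof (rule multilinear_cong)
    fix w :: "('a, 'c) letter list" assume "w \<in> words ([Algebra, Coalgebra] @ replicate n Algebra)"
    then have "w \<noteq> []" using words_length by fastforce
    then show "pure_tensor (drop (length [Algebra]) w @ take (length [Algebra]) w) = pure_tensor (rotate1 w)"
      by (cases w) auto
  qed
qed

lemma bilinear_rotated:
  assumes "length as = n"
  shows "bilinear (CA (Suc n)) (\<lambda>a c. pure_tensor (word c (as @ [a])))"
  using bilinear_context[OF rotated_multilinear map_Alg_words[OF assms]] by (simp add: word_def)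

lemma rotation_multilinear:
  "multilinear (CA (n + 1)) (CA (n + 1)) (\<lambda>w. (\<lambda>c as. sweedler c (hd as)
     (\<lambda>a' c'. pure_tensor (word c' (tl as @ [a'])))) (coalg (hd w)) (map alg (tl w)))"
proof (rule multilinear_cong)
  have "[Coalgebra, Algebra] @ replicate n Algebra = CA (n + 1)" by (simp add: CA_def)
  with sweedler_multilinear[OF rotated_multilinear, of n]
  show "multilinear (CA (n + 1)) (CA (n + 1)) (\<lambda>w. sweedler (coalg (w ! 0)) (alg (w ! 1))
      (\<lambda>a c. pure_tensor (rotate1 (Alg a # Coalg c # drop 2 w))))" by simp
  fix w :: "('a, 'c) letter list" assume "w \<in> words (CA (n + 1))"
  then obtain c a as where "w = word c (a # as)" by (auto simp: words_CA length_Suc_conv)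
  then show "sweedler (coalg (w ! 0)) (alg (w ! 1)) (\<lambda>a c. pure_tensor (rotate1 (Alg a # Coalg c # drop 2 w)))
    = (\<lambda>c as. sweedler c (hd as) (\<lambda>a' c'. pure_tensor (word c' (tl as @ [a'])))) (coalg (hd w)) (map alg (tl w))"
    by (simp add: word_def comp_def)
qed

lemma rotation_linear: "linear_map (CA (n + 1)) (CA (n + 1)) (rotation n)"
  unfolding rotation_def lift_CA_def by (rule lift_linear[OF rotation_multilinear])

lemma rotation_word:
  assumes "length as = n"
  shows "rotation n (pure_tensor (word c (a # as))) = sweedler c a (\<lambda>a' c'. pure_tensor (word c' (as @ [a'])))"
proof -
  have "word c (a # as) \<in> words (CA (n + 1))" by (rule word_words) (simp add: assms)
  from lift_pure[OF rotation_multilinear this] show ?thesis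
    unfolding rotation_def lift_CA_def by (simp add: word_simps)
qed

lemma degeneracy_multilinear:
  assumes "j \<le> n + 1"
  shows "multilinear (CA (n + 1)) (CA (n + 2))
    (\<lambda>w. (\<lambda>c as. pure_tensor (word c (take j as @ [1] @ drop j as))) (coalg (hd w)) (map alg (tl w)))"
proof (rule multilinear_cong)
  have "multilinear [] [Algebra] (\<lambda>w. pure_tensor [Alg 1])"
    using pure_Alg_in by (simp add: multilinear_def words_def)
  from multilinear_local[OF this, of "CA j" "replicate (n + 1 - j) Algebra"]
  have "multilinear (CA j @ replicate (n + 1 - j) Algebra) (CA j @ Algebra # replicate (n + 1 - j) Algebra)
    (\<lambda>w. pure_tensor (take (Suc j) w @ [Alg 1] @ drop (Suc j) w))" by (simp add: CA_def)
  moreover have "CA j @ replicate (n + 1 - j) Algebra = CA (n + 1)"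
    using assms by (simp add: CA_def flip: replicate_add)
  moreover have "CA j @ Algebra # replicate (n + 1 - j) Algebra = CA (n + 2)"
    using assms by (simp add: CA_def flip: replicate_Suc replicate_add)
  ultimately show "multilinear (CA (n + 1)) (CA (n + 2))
    (\<lambda>w. pure_tensor (take (Suc j) w @ [Alg 1] @ drop (Suc j) w))" by simp
  fix w :: "('a, 'c) letter list" assume "w \<in> words (CA (n + 1))"
  then obtain c as where "w = word c as" by (auto simp: words_CA)
  then show "pure_tensor (take (Suc j) w @ [Alg 1] @ drop (Suc j) w)
    = (\<lambda>c as. pure_tensor (word c (take j as @ [1] @ drop j as))) (coalg (hd w)) (map alg (tl w))"
    by (simp add: word_def comp_def take_map drop_map)
qed

lemma degeneracy_linear: "j \<le> n + 1 \<Longrightarrow> linear_map (CA (n + 1)) (CA (n + 2)) (degeneracy n j)"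
  unfolding degeneracy_def lift_CA_def by (rule lift_linear[OF degeneracy_multilinear])

lemma degeneracy_word:
  assumes "j \<le> n + 1" "length as = n + 1"
  shows "degeneracy n j (pure_tensor (word c as)) = pure_tensor (word c (insert_one j as))"
  unfolding degeneracy_def lift_CA_def insert_one_def
    lift_pure[OF degeneracy_multilinear[OF assms(1)] word_words[OF assms(2)]]
  by (simp add: word_simps)

lemma face_Suc_multilinear:
  assumes "i \<le> n"
  shows "multilinear (CA (n + 2)) (CA (n + 1))
    (\<lambda>w. pure_tensor (word (coalg (hd w)) (merge_at i (map alg (tl w)))))"
proof (rule multilinear_cong)
  let ?r = "replicate (n - i) Algebra"
  have "multilinear (CA i @ [Algebra, Algebra] @ ?r) (CA i @ [Algebra] @ ?r)
    (\<lambda>w. pure_tensor (take (Suc i) w @ [Alg (alg (take 2 (drop (Suc i) w) ! 0) * alg (take 2 (drop (Suc i) w) ! 1))]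
      @ drop (Suc i + 2) w))"
    using multilinear_local[OF product_multilinear, of "CA i" ?r] by (simp add: CA_def numeral_2_eq_2)
  moreover have "CA i @ [Algebra, Algebra] @ ?r = CA (n + 2)"
    using assms by (simp add: CA_def flip: replicate_Suc replicate_add)
  moreover have "CA i @ [Algebra] @ ?r = CA (n + 1)"
    using assms by (simp add: CA_def flip: replicate_Suc replicate_add)
  ultimately show "multilinear (CA (n + 2)) (CA (n + 1))
    (\<lambda>w. pure_tensor (take (Suc i) w @ [Alg (alg (take 2 (drop (Suc i) w) ! 0) * alg (take 2 (drop (Suc i) w) ! 1))]
      @ drop (Suc i + 2) w))" by simp
  fix w :: "('a, 'c) letter list" assume "w \<in> words (CA (n + 2))"
  then obtain c as where "w = word c as" "length as = n + 2" by (auto simp: words_CA)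
  then show "pure_tensor (take (Suc i) w @ [Alg (alg (take 2 (drop (Suc i) w) ! 0) * alg (take 2 (drop (Suc i) w) ! 1))]
      @ drop (Suc i + 2) w) = pure_tensor (word (coalg (hd w)) (merge_at i (map alg (tl w))))"
    using assms by (simp add: word_def comp_def take_map drop_map merge_at_def)
qed

lemma face_Suc: "face n (Suc i) = lift (CA (n + 2)) (\<lambda>w. pure_tensor (word (coalg (hd w)) (merge_at i (map alg (tl w)))))"
  unfolding face_def lift_CA_def merge_at_def by simp

lemma face_Suc_linear: "i \<le> n \<Longrightarrow> linear_map (CA (n + 2)) (CA (n + 1)) (face n (Suc i))"
  unfolding face_Suc by (rule lift_linear[OF face_Suc_multilinear])

lemma face_Suc_word:
  assumes "i \<le> n" "length as = n + 2"
  shows "face n (Suc i) (pure_tensor (word c as)) = pure_tensor (word c (merge_at i as))"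
  unfolding face_Suc lift_pure[OF face_Suc_multilinear[OF assms(1)] word_words[OF assms(2)]]
  by (simp add: word_simps)

text \<open>The defining formula of the zeroth face is not multilinear at first sight. It is so because on words it agrees with a
  composition of linear maps, the last face after a rotation.\<close>

lemma face_zero_multilinear:
  "multilinear (CA (n + 2)) (CA (n + 1)) (\<lambda>w. (\<lambda>c as.
     sweedler c (hd as) (\<lambda>a' c'. pure_tensor (word c' (butlast (tl as) @ [last (tl as) * a']))))
     (coalg (hd w)) (map alg (tl w)))" (is "multilinear _ _ ?\<phi>")
  and face_zero_last_word: "w \<in> words (CA (n + 2)) \<Longrightarrow>
     face n (n + 1) (rotation (n + 1) (pure_tensor w)) = (\<lambda>c as.
     sweedler c (hd as) (\<lambda>a' c'. pure_tensor (word c' (butlast (tl as) @ [last (tl as) * a']))))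
     (coalg (hd w)) (map alg (tl w))"
proof -
  have last: "linear_map (CA (n + 2)) (CA (n + 1)) (face n (n + 1))"
    using face_Suc_linear[of n n] by simp
  show *: "face n (n + 1) (rotation (n + 1) (pure_tensor w)) = ?\<phi> w"
    if w: "w \<in> words (CA (n + 2))" for w
  proof -
    obtain c a as where w: "w = word c (a # as)" "length as = n + 1"
      using w by (auto simp: words_CA length_Suc_conv)
    then obtain bs b where as: "as = bs @ [b]" by (cases as rule: rev_cases) auto
    have "merge_at n (as @ [a']) = butlast as @ [last as * a']" for a'
      using merge_last[of bs b a'] w(2) by (simp add: as)
    then have "face n (n + 1) (pure_tensor (word c' (as @ [a'])))
        = pure_tensor (word c' (butlast as @ [last as * a']))" for a' c'
      using face_Suc_word[of n n "as @ [a']" c'] w(2) by simp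
    with sweedler_linear_map[OF bilinear_rotated[OF w(2)], of "CA (n + 1)" "face n (n + 1)" c a] last
    show ?thesis
      unfolding w(1) rotation_word[OF w(2)] word_simps by simp
  qed
  have "linear_map (CA (n + 2)) (CA (n + 1)) (\<lambda>t. face n (n + 1) (rotation (n + 1) t))"
    using linear_map_comp[OF rotation_linear[of "n + 1"]] last by (simp add: add.assoc)
  from multilinear_cong[OF linear_map_multilinear[OF this] *]
  show "multilinear (CA (n + 2)) (CA (n + 1)) ?\<phi>" .
qed

lemma face_0: "face n 0 = lift (CA (n + 2)) (\<lambda>w. (\<lambda>c as.
     sweedler c (hd as) (\<lambda>a' c'. pure_tensor (word c' (butlast (tl as) @ [last (tl as) * a']))))
     (coalg (hd w)) (map alg (tl w)))"
  unfolding face_def lift_CA_def by simp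

lemma face_linear:
  assumes "i \<le> n + 1"
  shows "linear_map (CA (n + 2)) (CA (n + 1)) (face n i)"
proof (cases i)
  case 0
  then show ?thesis using lift_linear[OF face_zero_multilinear] by (simp add: face_0)
next
  case (Suc k)
  then show ?thesis using assms face_Suc_linear by simp
qed

lemma face_zero_word:
  assumes "length as = n + 1"
  shows "face n 0 (pure_tensor (word c (a # as)))
    = sweedler c a (\<lambda>a' c'. pure_tensor (word c' (butlast as @ [last as * a'])))"
  using lift_pure[OF face_zero_multilinear word_words, of "a # as" n c] assms
  by (simp add: face_0 word_simps)


section \<open>The cyclic identities on chains\<close>

lemma rotation_in: "t \<in> T (CA (n + 1)) \<Longrightarrow> rotation n t \<in> T (CA (n + 1))"
  by (rule linear_map_in[OF rotation_linear])

text \<open>The shapes one degree higher, with the degree shift written as in the identities below.\<close>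

lemma degeneracy_linear_shift: "j \<le> n + 2 \<Longrightarrow> linear_map (CA (n + 2)) (CA (n + 3)) (degeneracy (n + 1) j)"
  using degeneracy_linear[of j "n + 1"] by (simp add: numeral_3_eq_3)

lemma face_linear_shift: "i \<le> n + 2 \<Longrightarrow> linear_map (CA (n + 3)) (CA (n + 2)) (face (n + 1) i)"
  using face_linear[of i "n + 1"] by (simp add: numeral_3_eq_3)

lemma rotation_linear_shift: "linear_map (CA (n + 2)) (CA (n + 2)) (rotation (n + 1))"
  using rotation_linear[of "n + 1"] by (simp add: add.assoc)

lemma rotation_in_shift: "t \<in> T (CA (n + 2)) \<Longrightarrow> rotation (n + 1) t \<in> T (CA (n + 2))"
  by (rule linear_map_in[OF rotation_linear_shift])

lemma face_zero_rotation:
  assumes "t \<in> T (CA (n + 2))"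
  shows "face n 0 t = face n (n + 1) (rotation (n + 1) t)"
proof (rule CA_eqI[OF assms, where F = "face n 0" and G = "\<lambda>t. face n (n + 1) (rotation (n + 1) t)"])
  show "linear_map (CA (n + 2)) (CA (n + 1)) (\<lambda>t. face n (n + 1) (rotation (n + 1) t))"
    by (rule linear_map_comp[OF rotation_linear_shift face_linear]) simp
  fix c and as :: "'a list" assume as: "length as = n + 2"
  show "face n 0 (pure_tensor (word c as)) = face n (n + 1) (rotation (n + 1) (pure_tensor (word c as)))"
    unfolding face_0 lift_pure[OF face_zero_multilinear word_words[OF as]]
      face_zero_last_word[OF word_words[OF as]] ..
qed (rule face_linear, simp)

text \<open>For \<open>i = 0\<close> the left side moves \<open>c\<close> past the product of the first two letters, the right side past
  one after the other, so this is the product axiom. For \<open>i > 0\<close> the merged letters are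
  not the one that \<open>c\<close> moves past.\<close>

lemma rotation_face:
  assumes "i \<le> n" "t \<in> T (CA (n + 2))"
  shows "rotation n (face n (Suc i) t) = face n i (rotation (n + 1) t)"
proof (rule CA_eqI[OF assms(2), where F = "\<lambda>t. rotation n (face n (Suc i) t)"
      and G = "\<lambda>t. face n i (rotation (n + 1) t)"])
  show "linear_map (CA (n + 2)) (CA (n + 1)) (\<lambda>t. rotation n (face n (Suc i) t))"
    by (rule linear_map_comp[OF face_linear rotation_linear]) (simp add: assms(1))
  show "linear_map (CA (n + 2)) (CA (n + 1)) (\<lambda>t. face n i (rotation (n + 1) t))"
    by (rule linear_map_comp[OF rotation_linear_shift face_linear]) (use assms(1) in simp)
  fix c and as :: "'a list" assume len: "length as = n + 2"
  then obtain a b bs where as: "as = a # b # bs" and bs: "length bs = n"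
    by (auto simp: length_Suc_conv)
  then have bs': "length (b # bs) = n + 1" by simp
  have F: "linear_map (CA (Suc (n + 1))) (CA (n + 1)) (face n i)"
    using face_linear[of i n] assms(1) by simp
  have R: "face n i (rotation (n + 1) (pure_tensor (word c as)))
    = sweedler c a (\<lambda>a' c'. face n i (pure_tensor (word c' ((b # bs) @ [a']))))"
    unfolding as rotation_word[OF bs'] by (rule sweedler_linear_map[OF bilinear_rotated[OF bs'] F])
  show "rotation n (face n (Suc i) (pure_tensor (word c as)))
    = face n i (rotation (n + 1) (pure_tensor (word c as)))"
  proof (cases i)
    case 0
    have "face n (Suc i) (pure_tensor (word c as)) = pure_tensor (word c (a * b # bs))"
      using face_Suc_word[OF assms(1) len, of c] by (simp add: 0 as)
    then have "rotation n (face n (Suc i) (pure_tensor (word c as)))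
      = sweedler c (a * b) (\<lambda>a' c'. pure_tensor (word c' (bs @ [a'])))"
      by (simp add: rotation_word[OF bs])
    also have "\<dots> = sweedler c a (\<lambda>a' c'. sweedler c' b (\<lambda>b' c''. pure_tensor (word c'' (bs @ [a' * b']))))"
      by (rule sweedler_mult[OF bilinear_rotated[OF bs]])
    also have "\<dots> = sweedler c a (\<lambda>a' c'. face n i (pure_tensor (word c' ((b # bs) @ [a']))))"
      using face_zero_word[of "bs @ [_]" n _ b] bs by (simp add: 0)
    finally show ?thesis by (simp only: R)
  next
    case (Suc k)
    have "length (merge_at k (b # bs)) = n"
      using length_merge[of k "b # bs"] assms(1) bs' Suc by simp
    moreover have "face n (Suc i) (pure_tensor (word c as)) = pure_tensor (word c (a # merge_at k (b # bs)))"
      using face_Suc_word[OF assms(1) len, of c] by (simp add: Suc as)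
    ultimately have "rotation n (face n (Suc i) (pure_tensor (word c as)))
      = sweedler c a (\<lambda>a' c'. pure_tensor (word c' (merge_at k (b # bs) @ [a'])))"
      by (simp add: rotation_word)
    also have "\<dots> = sweedler c a (\<lambda>a' c'. face n i (pure_tensor (word c' ((b # bs) @ [a']))))"
      using face_Suc_word[of k n "(b # bs) @ [_]"] merge_append[of k "b # bs"] assms(1) bs' Suc by simp
    finally show ?thesis by (simp only: R)
  qed
qed

lemma rotation_degeneracy:
  assumes "j < n + 1" "t \<in> T (CA (n + 1))"
  shows "rotation (n + 1) (degeneracy n (Suc j) t) = degeneracy n j (rotation n t)"
proof (rule CA_eqI[OF assms(2), where F = "\<lambda>t. rotation (n + 1) (degeneracy n (Suc j) t)"
      and G = "\<lambda>t. degeneracy n j (rotation n t)"])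
  show "linear_map (CA (n + 1)) (CA (n + 2)) (\<lambda>t. rotation (n + 1) (degeneracy n (Suc j) t))"
    by (rule linear_map_comp[OF degeneracy_linear rotation_linear_shift]) (use assms(1) in simp)
  show "linear_map (CA (n + 1)) (CA (n + 2)) (\<lambda>t. degeneracy n j (rotation n t))"
    by (rule linear_map_comp[OF rotation_linear degeneracy_linear]) (use assms(1) in simp)
  fix c and as :: "'a list" assume len: "length as = n + 1"
  then obtain a bs where as: "as = a # bs" and bs: "length bs = n"
    by (auto simp: length_Suc_conv)
  have D: "linear_map (CA (Suc n)) (CA (n + 2)) (degeneracy n j)"
    using degeneracy_linear[of j n] assms(1) by simp
  have bs': "length (insert_one j bs) = n + 1" using bs by (simp add: length_insert_one)
  have "degeneracy n (Suc j) (pure_tensor (word c as)) = pure_tensor (word c (a # insert_one j bs))"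
    using degeneracy_word[of "Suc j" n as c] assms(1) len by (simp add: as)
  then have "rotation (n + 1) (degeneracy n (Suc j) (pure_tensor (word c as)))
    = sweedler c a (\<lambda>a' c'. pure_tensor (word c' (insert_one j bs @ [a'])))"
    by (simp only: rotation_word[OF bs'])
  also have "\<dots> = sweedler c a (\<lambda>a' c'. degeneracy n j (pure_tensor (word c' (bs @ [a']))))"
    using degeneracy_word[of j n "bs @ [_]"] insert_one_append[of j bs] assms(1) bs by simp
  also have "\<dots> = degeneracy n j (rotation n (pure_tensor (word c as)))"
    unfolding as rotation_word[OF bs] by (rule sweedler_linear_map[OF bilinear_rotated[OF bs] D, symmetric])
  finally show "rotation (n + 1) (degeneracy n (Suc j) (pure_tensor (word c as)))
    = degeneracy n j (rotation n (pure_tensor (word c as)))" .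
qed

text \<open>By the unit axiom the first rotation just carries the inserted unit to the end; the second then puts
  the first of the original letters behind it.\<close>

lemma rotation_rotation_degeneracy:
  assumes "t \<in> T (CA (n + 1))"
  shows "rotation (n + 1) (rotation (n + 1) (degeneracy n 0 t)) = degeneracy n n (rotation n t)"
proof (rule CA_eqI[OF assms, where F = "\<lambda>t. rotation (n + 1) (rotation (n + 1) (degeneracy n 0 t))"
      and G = "\<lambda>t. degeneracy n n (rotation n t)"])
  show "linear_map (CA (n + 1)) (CA (n + 2)) (\<lambda>t. rotation (n + 1) (rotation (n + 1) (degeneracy n 0 t)))"
    by (rule linear_map_comp[OF linear_map_comp[OF degeneracy_linear rotation_linear_shift] rotation_linear_shift]) simp
  show "linear_map (CA (n + 1)) (CA (n + 2)) (\<lambda>t. degeneracy n n (rotation n t))"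
    by (rule linear_map_comp[OF rotation_linear degeneracy_linear]) simp
  fix c and as :: "'a list" assume len: "length as = n + 1"
  then obtain a bs where as: "as = a # bs" and bs: "length bs = n"
    by (auto simp: length_Suc_conv)
  have D: "linear_map (CA (Suc n)) (CA (n + 2)) (degeneracy n n)"
    using degeneracy_linear[of n n] by simp
  have "degeneracy n 0 (pure_tensor (word c as)) = pure_tensor (word c (1 # as))"
    using degeneracy_word[of 0 n as c] len by simp
  then have "rotation (n + 1) (degeneracy n 0 (pure_tensor (word c as))) = pure_tensor (word c (as @ [1]))"
    by (simp only: rotation_word[OF len] sweedler_one[OF bilinear_rotated[OF len]])
  then have "rotation (n + 1) (rotation (n + 1) (degeneracy n 0 (pure_tensor (word c as))))
    = sweedler c a (\<lambda>a' c'. pure_tensor (word c' ((bs @ [1]) @ [a'])))"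
    using rotation_word[of "bs @ [1]" "n + 1" c a] bs by (simp add: as)
  also have "\<dots> = sweedler c a (\<lambda>a' c'. degeneracy n n (pure_tensor (word c' (bs @ [a']))))"
    using degeneracy_word[of n n "bs @ [_]"] bs by (simp add: insert_one_def)
  also have "\<dots> = degeneracy n n (rotation n (pure_tensor (word c as)))"
    unfolding as rotation_word[OF bs] by (rule sweedler_linear_map[OF bilinear_rotated[OF bs] D, symmetric])
  finally show "rotation (n + 1) (rotation (n + 1) (degeneracy n 0 (pure_tensor (word c as))))
    = degeneracy n n (rotation n (pure_tensor (word c as)))" .
qed


section \<open>The simplicial identities on chains\<close>

text \<open>Associativity of the product if the two faces overlap; otherwise they merge disjoint pairs of letters.\<close>

lemma face_Suc_face_Suc:
  assumes "i < j" "j \<le> n + 1" "t \<in> T (CA (n + 3))"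
  shows "face n (Suc i) (face (n + 1) (Suc j) t) = face n j (face (n + 1) (Suc i) t)"
proof -
  obtain k where k: "j = Suc k" using assms(1) by (cases j) auto
  have L: "linear_map (CA (n + 3)) (CA (n + 1)) (\<lambda>t. face n (Suc i) (face (n + 1) (Suc j) t))"
    by (rule linear_map_comp[OF face_linear_shift face_linear]) (use assms in simp_all)
  have R: "linear_map (CA (n + 3)) (CA (n + 1)) (\<lambda>t. face n j (face (n + 1) (Suc i) t))"
    by (rule linear_map_comp[OF face_linear_shift face_linear]) (use assms in simp_all)
  show ?thesis
  proof (rule CA_eqI[OF assms(3) L R])
    fix c and as :: "'a list" assume len: "length as = n + 3"
    then have "face n (Suc i) (face (n + 1) (Suc j) (pure_tensor (word c as)))
      = pure_tensor (word c (merge_at i (merge_at j as)))"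
      using assms by (simp add: face_Suc_word length_merge)
    also have "merge_at i (merge_at j as) = merge_at k (merge_at i as)"
      using merge_merge[of i j as] assms len by (simp add: k)
    also have "pure_tensor (word c (merge_at k (merge_at i as))) = face n j (face (n + 1) (Suc i) (pure_tensor (word c as)))"
      using assms len by (simp add: face_Suc_word length_merge k)
    finally show "face n (Suc i) (face (n + 1) (Suc j) (pure_tensor (word c as)))
      = face n j (face (n + 1) (Suc i) (pure_tensor (word c as)))" .
  qed
qed

text \<open>The identities that involve \<open>F\<^sub>0\<close> follow from the others: write \<open>F\<^sub>0\<close> as the last face after a
  rotation, pass the rotation through the other face, and commute the two nonzero faces. If the other
  face is \<open>F\<^sub>1\<close>, it has become \<open>F\<^sub>0\<close>, and the same step is repeated.\<close>

lemma face_face: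
  assumes "i < j" "j \<le> n + 2" and t: "t \<in> T (CA (n + 3))"
  shows "face n i (face (n + 1) j t) = face n (j - 1) (face (n + 1) i t)"
proof (cases i)
  case (Suc k)
  then obtain l where "j = Suc l" using assms(1) by (cases j) auto
  then show ?thesis using face_Suc_face_Suc[of k l n t] assms Suc by simp
next
  case 0
  have face': "face (n + 1) k t \<in> T (CA (n + 2))" if "k \<le> n + 2" "t \<in> T (CA (n + 3))" for k t
    using linear_map_in[OF face_linear_shift] that .
  have Rt: "rotation (n + 2) t \<in> T (CA (n + 3))"
    using rotation_in[of t "n + 2"] t by (simp add: numeral_3_eq_3)
  have zero: "face (n + 1) 0 t = face (n + 1) (n + 2) (rotation (n + 2) t)"
    if "t \<in> T (CA (n + 3))" for t
    using face_zero_rotation[of t "n + 1"] that by (simp add: numeral_3_eq_3)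
  have rot: "rotation (n + 1) (face (n + 1) (Suc k) t) = face (n + 1) k (rotation (n + 2) t)"
    if "k \<le> n + 1" "t \<in> T (CA (n + 3))" for k t
    using rotation_face[of k "n + 1" t] that by (simp add: numeral_3_eq_3)
  obtain l where l: "j = Suc l" using assms(1) by (cases j) auto
  have "face n 0 (face (n + 1) j t) = face n (n + 1) (rotation (n + 1) (face (n + 1) j t))"
    by (rule face_zero_rotation[OF face'[OF assms(2) t]])
  also have "\<dots> = face n (n + 1) (face (n + 1) l (rotation (n + 2) t))"
    using rot[of l t] assms(2) t by (simp add: l)
  also have "\<dots> = face n l (face (n + 1) (n + 2) (rotation (n + 2) t))"
  proof (cases l)
    case (Suc k)
    then show ?thesis using face_Suc_face_Suc[of k "n + 1" n, OF _ _ Rt] assms(2) l by simp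
  next
    case l0: 0
    \<comment> \<open>Here passing the rotation has turned \<open>F\<^sub>1\<close> into \<open>F\<^sub>0\<close>, again the last face after a rotation.\<close>
    have RR: "rotation (n + 2) (rotation (n + 2) t) \<in> T (CA (n + 3))"
      using rotation_in[of "rotation (n + 2) t" "n + 2"] Rt by (simp add: numeral_3_eq_3)
    have "face n (n + 1) (face (n + 1) 0 (rotation (n + 2) t))
      = face n (n + 1) (face (n + 1) (n + 2) (rotation (n + 2) (rotation (n + 2) t)))"
      by (simp only: zero[OF Rt])
    also have "\<dots> = face n (n + 1) (face (n + 1) (n + 1) (rotation (n + 2) (rotation (n + 2) t)))"
      using face_Suc_face_Suc[of n "n + 1" n, OF _ _ RR] by simp
    also have "\<dots> = face n (n + 1) (rotation (n + 1) (face (n + 1) (n + 2) (rotation (n + 2) t)))"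
      using rot[of "n + 1", OF _ Rt] by simp
    also have "\<dots> = face n 0 (face (n + 1) (n + 2) (rotation (n + 2) t))"
      by (rule face_zero_rotation[symmetric]) (use face' Rt in simp)
    finally show ?thesis by (simp only: l0)
  qed
  also have "\<dots> = face n l (face (n + 1) 0 t)" by (simp only: zero[OF t])
  finally show ?thesis by (simp add: 0 l)
qed

lemma degeneracy_degeneracy:
  assumes "i \<le> j" "j \<le> n" "t \<in> T (CA (n + 1))"
  shows "degeneracy (n + 1) i (degeneracy n j t) = degeneracy (n + 1) (j + 1) (degeneracy n i t)"
proof -
  have L: "linear_map (CA (n + 1)) (CA (n + 3)) (\<lambda>t. degeneracy (n + 1) i (degeneracy n j t))"
    by (rule linear_map_comp[OF degeneracy_linear degeneracy_linear_shift]) (use assms in simp_all)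
  have R: "linear_map (CA (n + 1)) (CA (n + 3)) (\<lambda>t. degeneracy (n + 1) (j + 1) (degeneracy n i t))"
    by (rule linear_map_comp[OF degeneracy_linear degeneracy_linear_shift]) (use assms in simp_all)
  show ?thesis
    by (rule CA_eqI[OF assms(3) L R])
      (use assms in \<open>simp add: degeneracy_word length_insert_one insert_one_insert_one[of i j]\<close>)
qed

text \<open>For \<open>F\<^sub>0 D\<^sub>0\<close> the inserted unit is moved past \<open>C\<close>, which the unit axiom permits, and then multiplied onto
  the last letter.\<close>

lemma face_degeneracy_same:
  assumes "j \<le> n" "i = j \<or> i = j + 1" and t: "t \<in> T (CA (n + 1))"
  shows "face n i (degeneracy n j t) = t"
proof -
  have nonzero: "face n (Suc k) (degeneracy n l t) = t"
    if "k \<le> n" "l = k \<or> l = Suc k" for k l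
  proof -
    have L: "linear_map (CA (n + 1)) (CA (n + 1)) (\<lambda>t. face n (Suc k) (degeneracy n l t))"
      by (rule linear_map_comp[OF degeneracy_linear face_linear]) (use that in auto)
    show ?thesis
    proof (rule CA_eqI[OF t L linear_map_id(2)])
      fix c and as :: "'a list" assume len: "length as = n + 1"
      then have "merge_at k (insert_one l as) = as"
        using that merge_insert_one_left[of k as] merge_insert_one_right[of k as] by auto
      moreover have "l \<le> n + 1" using that by auto
      ultimately show "face n (Suc k) (degeneracy n l (pure_tensor (word c as))) = pure_tensor (word c as)"
        using that len by (simp add: degeneracy_word face_Suc_word length_insert_one)
    qed
  qed
  show ?thesis
  proof (cases i)
    case (Suc k)
    then show ?thesis using nonzero[of k j] assms by auto
  next
    case 0
    then have j: "j = 0" using assms by simp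
    have L: "linear_map (CA (n + 1)) (CA (n + 1)) (\<lambda>t. face n 0 (degeneracy n 0 t))"
      by (rule linear_map_comp[OF degeneracy_linear face_linear]) simp_all
    have "face n 0 (degeneracy n 0 t) = t"
    proof (rule CA_eqI[OF t L linear_map_id(2)])
      fix c and as :: "'a list" assume len: "length as = n + 1"
      then obtain bs b where as: "as = bs @ [b]" by (cases as rule: rev_cases) auto
      have "bilinear (CA (n + 1)) (\<lambda>a c. pure_tensor (word c (butlast as @ [last as * a])))"
      proof -
        have F: "linear_map (CA (Suc (n + 1))) (CA (n + 1)) (face n (n + 1))"
          using face_linear[of "n + 1" n] by simp
        have "face n (n + 1) (pure_tensor (word c (as @ [a]))) = pure_tensor (word c (butlast as @ [last as * a]))" for a c
          using face_Suc_word[of n n "as @ [a]" c] merge_last[of bs b a] len by (simp add: as)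
        then show ?thesis
          using multilinear_linear_map[OF bilinear_rotated[OF len, unfolded bilinear_def] F]
          by (simp add: bilinear_def)
      qed
      from sweedler_one[OF this]
      show "face n 0 (degeneracy n 0 (pure_tensor (word c as))) = pure_tensor (word c as)"
        using len by (simp add: degeneracy_word face_zero_word as)
    qed
    then show ?thesis by (simp only: 0 j)
  qed
qed

lemma face_degeneracy_greater:
  assumes "j + 1 < i" "i \<le> n + 2" and t: "t \<in> T (CA (n + 2))"
  shows "face (n + 1) i (degeneracy (n + 1) j t) = degeneracy n j (face n (i - 1) t)"
proof -
  have L: "linear_map (CA (n + 2)) (CA (n + 2)) (\<lambda>t. face (n + 1) i (degeneracy (n + 1) j t))"
    by (rule linear_map_comp[OF degeneracy_linear_shift face_linear_shift]) (use assms in simp_all)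
  have R: "linear_map (CA (n + 2)) (CA (n + 2)) (\<lambda>t. degeneracy n j (face n (i - 1) t))"
    by (rule linear_map_comp[OF face_linear degeneracy_linear]) (use assms in simp_all)
  obtain k where k: "i = Suc (Suc k)" using assms(1) by (cases i; cases "i - 1") auto
  show ?thesis
    by (rule CA_eqI[OF t L R])
      (use assms k in \<open>simp add: degeneracy_word face_Suc_word length_insert_one length_merge
        merge_insert_one_greater\<close>)
qed

text \<open>For \<open>i = 0\<close> the identity is reduced to that of the last face by passing a rotation through the
  degeneracy.\<close>

lemma face_degeneracy_less:
  assumes "i < j" "j \<le> n + 1" and t: "t \<in> T (CA (n + 2))"
  shows "face (n + 1) i (degeneracy (n + 1) j t) = degeneracy n (j - 1) (face n i t)"
proof (cases i)
  case (Suc k)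
  have L: "linear_map (CA (n + 2)) (CA (n + 2)) (\<lambda>t. face (n + 1) i (degeneracy (n + 1) j t))"
    by (rule linear_map_comp[OF degeneracy_linear_shift face_linear_shift]) (use assms in simp_all)
  have R: "linear_map (CA (n + 2)) (CA (n + 2)) (\<lambda>t. degeneracy n (j - 1) (face n i t))"
    by (rule linear_map_comp[OF face_linear degeneracy_linear]) (use assms in simp_all)
  show ?thesis
    by (rule CA_eqI[OF t L R])
      (use assms Suc in \<open>simp add: degeneracy_word face_Suc_word length_insert_one length_merge
        merge_insert_one_less\<close>)
next
  case 0
  obtain l where l: "j = Suc l" using assms(1) by (cases j) auto
  have Dt: "degeneracy (n + 1) j t \<in> T (CA (n + 3))"
    by (rule linear_map_in[OF degeneracy_linear_shift t]) (use assms in simp)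
  have "face (n + 1) 0 (degeneracy (n + 1) j t)
    = face (n + 1) (n + 2) (rotation (n + 2) (degeneracy (n + 1) j t))"
    using face_zero_rotation[of "degeneracy (n + 1) j t" "n + 1"] Dt by (simp add: numeral_3_eq_3)
  also have "\<dots> = face (n + 1) (n + 2) (degeneracy (n + 1) l (rotation (n + 1) t))"
    using rotation_degeneracy[of l "n + 1" t] assms t by (simp add: l)
  also have "\<dots> = degeneracy n l (face n (n + 1) (rotation (n + 1) t))"
    using face_degeneracy_greater[of l "n + 2" n, OF _ _ rotation_in_shift[OF t]] assms l by simp
  also have "\<dots> = degeneracy n l (face n 0 t)"
    by (simp only: face_zero_rotation[OF t])
  finally show ?thesis by (simp add: 0 l)
qed


section \<open>Invariance under the full rotation\<close>

lemma rotation_pow_in: "t \<in> T (CA (n + 1)) \<Longrightarrow> (rotation n ^^ k) t \<in> T (CA (n + 1))"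
  by (induction k) (auto intro: rotation_in[simplified])

lemma rotation_pow_in_shift: "t \<in> T (CA (n + 2)) \<Longrightarrow> (rotation (n + 1) ^^ k) t \<in> T (CA (n + 2))"
  by (induction k) (auto intro: rotation_in_shift[simplified])

lemma rotation_pow_linear: "linear_map (CA (n + 1)) (CA (n + 1)) (rotation n ^^ k)"
proof (induction k)
  case (Suc k)
  then show ?case using linear_map_comp[OF Suc rotation_linear] by (simp add: comp_def)
qed (simp add: linear_map_id)

lemma face_rotation_pow:
  assumes "i + k \<le> n + 1" "t \<in> T (CA (n + 2))"
  shows "face n i ((rotation (n + 1) ^^ k) t) = (rotation n ^^ k) (face n (i + k) t)"
  using assms(1)
proof (induction k arbitrary: i)
  case (Suc k)
  have "face n i ((rotation (n + 1) ^^ Suc k) t) = rotation n (face n (Suc i) ((rotation (n + 1) ^^ k) t))"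
    using rotation_face[of i n] Suc.prems rotation_pow_in_shift[OF assms(2)] by simp
  then show ?case using Suc.IH[of "Suc i"] Suc.prems by simp
qed simp

text \<open>Passing a rotation from the argument of a face to its value raises the index of the face by one. Of the \<open>n + 2\<close> rotations,
  \<open>n + 1 - i\<close> raise the index from \<open>i\<close> to \<open>n + 1\<close>, one is absorbed in \<open>F\<^sub>n\<^sub>+\<^sub>1 R = F\<^sub>0\<close>, and the
  remaining \<open>i\<close> raise the index to \<open>i\<close> again. So one rotation fewer appears on the right.\<close>

lemma face_full_rotation:
  assumes "i \<le> n + 1" and t: "t \<in> T (CA (n + 2))"
  shows "face n i ((rotation (n + 1) ^^ (n + 2)) t) = (rotation n ^^ (n + 1)) (face n i t)"
proof -
  let ?s = "(rotation (n + 1) ^^ i) t"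
  have s: "?s \<in> T (CA (n + 2))" by (rule rotation_pow_in_shift[OF t])
  have "n + 2 = (n + 1 - i) + Suc i" using assms(1) by simp
  then have "(rotation (n + 1) ^^ (n + 2)) t = (rotation (n + 1) ^^ (n + 1 - i)) (rotation (n + 1) ?s)"
    by (simp only: funpow_add comp_def funpow.simps)
  then have "face n i ((rotation (n + 1) ^^ (n + 2)) t)
    = (rotation n ^^ (n + 1 - i)) (face n (n + 1) (rotation (n + 1) ?s))"
    using face_rotation_pow[of i "n + 1 - i" n "rotation (n + 1) ?s"] rotation_in_shift[OF s] assms(1) by simp
  also have "\<dots> = (rotation n ^^ (n + 1 - i)) (face n 0 ?s)"
    by (simp only: face_zero_rotation[OF s])
  also have "\<dots> = (rotation n ^^ (n + 1 - i)) ((rotation n ^^ i) (face n i t))"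
    using face_rotation_pow[of 0 i n t] assms by simp
  also have "\<dots> = (rotation n ^^ ((n + 1 - i) + i)) (face n i t)" by (simp only: funpow_add comp_def)
  finally show ?thesis using assms(1) by simp
qed

lemma degeneracy_rotation_pow:
  assumes "j + k \<le> n + 1" "t \<in> T (CA (n + 1))"
  shows "(rotation (n + 1) ^^ k) (degeneracy n (j + k) t) = degeneracy n j ((rotation n ^^ k) t)"
  using assms(1)
proof (induction k arbitrary: j)
  case (Suc k)
  have "(rotation (n + 1) ^^ Suc k) (degeneracy n (j + Suc k) t)
    = rotation (n + 1) ((rotation (n + 1) ^^ k) (degeneracy n (Suc j + k) t))" by simp
  also have "\<dots> = rotation (n + 1) (degeneracy n (Suc j) ((rotation n ^^ k) t))"
    using Suc.IH[of "Suc j"] Suc.prems by simp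
  also have "\<dots> = degeneracy n j (rotation n ((rotation n ^^ k) t))"
    by (rule rotation_degeneracy) (use Suc.prems rotation_pow_in[OF assms(2)] in simp_all)
  finally show ?case by simp
qed simp

text \<open>The index goes once around the circle: \<open>j\<close> rotations lower it to \<open>0\<close>, the relation
  \<open>R R D\<^sub>0 = D\<^sub>n R\<close> resets it to \<open>n\<close> at the cost of one rotation, and \<open>n - j\<close> more bring it back to \<open>j\<close>.\<close>

lemma degeneracy_full_rotation:
  assumes "j \<le> n" and t: "t \<in> T (CA (n + 1))"
  shows "(rotation (n + 1) ^^ (n + 2)) (degeneracy n j t) = degeneracy n j ((rotation n ^^ (n + 1)) t)"
proof -
  let ?s = "(rotation n ^^ j) t"
  have s: "?s \<in> T (CA (n + 1))" by (rule rotation_pow_in[OF t])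
  have "n + 2 = (n - j) + Suc (Suc j)" using assms(1) by simp
  then have "(rotation (n + 1) ^^ (n + 2)) (degeneracy n j t)
    = (rotation (n + 1) ^^ (n - j)) (rotation (n + 1) (rotation (n + 1) ((rotation (n + 1) ^^ j) (degeneracy n j t))))"
    by (simp only: funpow_add comp_def funpow.simps)
  also have "(rotation (n + 1) ^^ j) (degeneracy n j t) = degeneracy n 0 ?s"
    using degeneracy_rotation_pow[of 0 j n t] assms by simp
  also have "rotation (n + 1) (rotation (n + 1) (degeneracy n 0 ?s)) = degeneracy n n (rotation n ?s)"
    by (rule rotation_rotation_degeneracy[OF s])
  also have "(rotation (n + 1) ^^ (n - j)) (degeneracy n n (rotation n ?s))
    = degeneracy n j ((rotation n ^^ (n - j)) (rotation n ?s))"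
    using degeneracy_rotation_pow[of j "n - j" n "rotation n ?s"] rotation_in[OF s] assms(1) by simp
  also have "(rotation n ^^ (n - j)) (rotation n ?s) = (rotation n ^^ ((n - j) + Suc j)) t"
    by (simp only: funpow_add comp_def funpow.simps)
  finally show ?thesis using assms(1) by simp
qed

lemma replicate_snoc: "replicate k x @ x # ys = replicate (Suc k) x @ ys"
  by (induction k) simp_all

lemma move_linear: "linear_map (CA m) (replicate m Algebra @ [Coalgebra]) (move m)"
proof (induction m)
  case 0
  have "move 0 = (\<lambda>t. t)" by (rule ext) simp
  then show ?case by (simp add: CA_def linear_map_id)
next
  case (Suc m)
  have 1: "linear_map (CA m @ [Algebra]) ((replicate m Algebra @ [Coalgebra]) @ [Algebra])
      (tensor_map (CA m) [Algebra] (move m) id)"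
    by (rule tensor_map_linear[OF Suc linear_map_id(1)])
  have 2: "linear_map (replicate m Algebra @ [Coalgebra, Algebra]) (replicate m Algebra @ [Algebra, Coalgebra])
      (tensor_map (replicate m Algebra) [Coalgebra, Algebra] id \<psi>)"
    by (rule tensor_map_linear[OF linear_map_id(1) entwining_linear])
  have "CA m @ [Algebra] = CA (Suc m)" by (simp add: CA_def replicate_append_same)
  moreover have "replicate m Algebra @ [Algebra, Coalgebra] = replicate (Suc m) Algebra @ [Coalgebra]"
    by (rule replicate_snoc)
  moreover have "move (Suc m) = (\<lambda>t. tensor_map (replicate m Algebra) [Coalgebra, Algebra] id \<psi>
       (tensor_map (CA m) [Algebra] (move m) id t))" by (rule ext) simp
  ultimately show ?case
    using linear_map_comp[OF 1[simplified append.assoc append_Cons append_Nil] 2]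
    by (simp only: append_Cons append_Nil)
qed

lemma move_step:
  assumes "length as = m"
  shows "move (Suc m) (pure_tensor (word c (as @ [a])))
    = tensor_map (replicate m Algebra) [Coalgebra, Algebra] id \<psi>
        (move m (pure_tensor (word c as)) \<otimes> pure_tensor [Alg a])"
proof -
  have "word c (as @ [a]) = word c as @ [Alg a]" by (simp add: word_def)
  then show ?thesis
    using tensor_map_pure[OF move_linear linear_map_id(1) word_words[OF assms], of "[Alg a]" "[Algebra]" c]
    by (simp add: words_A)
qed

text \<open>One step of the induction in \<open>rotation_pow_word\<close>, with an arbitrary tensor \<open>t\<close> in place of the
  result of moving \<open>C\<close> past the first \<open>k\<close> letters: by linearity \<open>t\<close> may be assumed pure.\<close>

lemma rotation_swapped:
  assumes len: "length bs = l" "k + l = n" and t: "t \<in> T (replicate k Algebra @ [Coalgebra])"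
  shows "rotation n (block_swap (replicate k Algebra) (CA (Suc l)) (t \<otimes> pure_tensor (map Alg (a # bs))))
    = block_swap (replicate (Suc k) Algebra) (CA l)
        (tensor_map (replicate k Algebra) [Coalgebra, Algebra] id \<psi> (t \<otimes> pure_tensor [Alg a])
          \<otimes> pure_tensor (map Alg bs))"
proof -
  let ?A = "\<lambda>k. replicate k Algebra"
  let ?\<psi> = "tensor_map (?A k) [Coalgebra, Algebra] id \<psi>"
  have bs: "pure_tensor (map Alg bs) \<in> T (?A l)" by (rule pure_in_T[OF map_Alg_words[OF len(1)]])
  have abs: "pure_tensor (map Alg (a # bs)) \<in> T (?A (Suc l))"
    by (rule pure_in_T, rule map_Alg_words) (simp add: len)
  have shapes: "(?A k @ [Coalgebra]) @ ?A (Suc l) = ?A k @ CA (Suc l)"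
      "CA (Suc l) @ ?A k = CA (n + 1)" "CA l @ ?A (Suc k) = CA (n + 1)"
      "(?A k @ [Algebra, Coalgebra]) @ ?A l = ?A (Suc k) @ CA l"
    using len(2) by (auto simp: CA_def replicate_snoc add.commute simp del: replicate_Suc simp flip: replicate_add)
  have swap_k: "linear_map (?A k @ CA (Suc l)) (CA (n + 1)) (block_swap (?A k) (CA (Suc l)))"
    using block_swap_linear[of "?A k" "CA (Suc l)"] unfolding shapes .
  have swap_Suc: "linear_map (?A (Suc k) @ CA l) (CA (n + 1)) (block_swap (?A (Suc k)) (CA l))"
    using block_swap_linear[of "?A (Suc k)" "CA l"] unfolding shapes .
  have \<psi>: "linear_map ((?A k @ [Coalgebra]) @ [Algebra]) (?A k @ [Algebra, Coalgebra]) ?\<psi>"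
    using tensor_map_linear[OF linear_map_id(1) entwining_linear, of "?A k"] by simp
  have con: "linear_map (?A k @ [Coalgebra]) (?A k @ CA (Suc l)) (\<lambda>t. t \<otimes> pure_tensor (map Alg (a # bs)))"
    using linear_map_concat_left[OF abs, of "?A k @ [Coalgebra]"] unfolding shapes .
  have con': "linear_map (?A k @ [Algebra, Coalgebra]) (?A (Suc k) @ CA l) (\<lambda>t. t \<otimes> pure_tensor (map Alg bs))"
    using linear_map_concat_left[OF bs, of "?A k @ [Algebra, Coalgebra]"] unfolding shapes .
  have L: "linear_map (?A k @ [Coalgebra]) (CA (n + 1)) (\<lambda>t. rotation n
      (block_swap (?A k) (CA (Suc l)) (t \<otimes> pure_tensor (map Alg (a # bs)))))"
    by (rule linear_map_comp[OF linear_map_comp[OF con swap_k] rotation_linear])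
  have R: "linear_map (?A k @ [Coalgebra]) (CA (n + 1)) (\<lambda>t. block_swap (?A (Suc k)) (CA l)
      (?\<psi> (t \<otimes> pure_tensor [Alg a]) \<otimes> pure_tensor (map Alg bs)))"
    by (rule linear_map_comp[OF linear_map_comp[OF linear_map_comp[OF
          linear_map_concat_left[OF pure_Alg_in] \<psi>] con'] swap_Suc])
  show ?thesis
  proof (rule linear_map_eqI[OF t L R])
    fix w :: "('a, 'c) letter list" assume "w \<in> words (?A k @ [Coalgebra])"
    then obtain us v where w: "w = map Alg us @ v" and v: "v \<in> words [Coalgebra]" and us: "length us = k"
      by (elim words_append_E) (auto simp: words_Algebra)
    from v obtain x where x: "v = [x]" "kind_of x = Coalgebra" by (auto simp: words_def)
    then obtain c where "x = Coalg c" by (cases x) auto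
    then have x: "v = [Coalg c]" using x by simp
    have u: "map Alg us \<in> words (?A k)" by (rule map_Alg_words[OF us])
    have "rotation n (block_swap (?A k) (CA (Suc l)) (pure_tensor w \<otimes> pure_tensor (map Alg (a # bs))))
      = rotation n (pure_tensor (word c (a # bs @ us)))"
      using block_swap_pure[OF u word_words[of "a # bs" "Suc l" c]] len(1)
      by (simp add: w x pure_tensor_concat word_def)
    also have "\<dots> = sweedler c a (\<lambda>a' c'. pure_tensor (word c' ((bs @ us) @ [a'])))"
      by (rule rotation_word) (use len us in simp)
    also have "\<dots> = block_swap (?A (Suc k)) (CA l)
      ((pure_tensor (map Alg us) \<otimes> \<psi> (pure_tensor [Coalg c, Alg a])) \<otimes> pure_tensor (map Alg bs))"
    proof (rule linear_on_psi(2)[OF linear_map_comp[OF linear_map_comp[OF linear_map_concat_right[OF pure_in_T[OF u]] con'] swap_Suc], symmetric])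
      fix a' c'
      have "map Alg (us @ [a']) \<in> words (?A (Suc k))" by (rule map_Alg_words) (simp add: us)
      from block_swap_pure[OF this word_words[OF len(1), of c']]
      show "block_swap (?A (Suc k)) (CA l)
          ((pure_tensor (map Alg us) \<otimes> pure_tensor [Alg a', Coalg c']) \<otimes> pure_tensor (map Alg bs))
        = pure_tensor (word c' ((bs @ us) @ [a']))"
        by (simp add: pure_tensor_concat word_def)
    qed
    also have "pure_tensor (map Alg us) \<otimes> \<psi> (pure_tensor [Coalg c, Alg a]) = ?\<psi> (pure_tensor w \<otimes> pure_tensor [Alg a])"
      using tensor_map_pure[OF linear_map_id(1) entwining_linear u, of "[Coalg c, Alg a]"]
      by (simp add: w x pure_tensor_concat words_CoA)
    finally show "rotation n (block_swap (?A k) (CA (Suc l)) (pure_tensor w \<otimes> pure_tensor (map Alg (a # bs))))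
      = block_swap (?A (Suc k)) (CA l) (?\<psi> (pure_tensor w \<otimes> pure_tensor [Alg a]) \<otimes> pure_tensor (map Alg bs))" .
  qed
qed

text \<open>Each rotation moves \<open>C\<close> past one more letter and puts that letter at the end. So after \<open>k\<close> of them
  \<open>C\<close> has moved past the first \<open>k\<close> letters, which now stand behind the others.\<close>

lemma rotation_pow_word:
  assumes "length as = k" "length bs = l" "k + l = n + 1"
  shows "(rotation n ^^ k) (pure_tensor (word c (as @ bs)))
    = block_swap (replicate k Algebra) (CA l) (move k (pure_tensor (word c as)) \<otimes> pure_tensor (map Alg bs))"
  using assms
proof (induction k arbitrary: as bs l)
  case 0
  then show ?case
    using block_swap_pure[of "[]" "[]" "word c bs" "CA l"] word_words[of bs l c]
    by (simp add: pure_tensor_concat word_def words_def)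
next
  case (Suc k)
  obtain cs a where as: "as = cs @ [a]" using Suc.prems by (cases as rule: rev_cases) auto
  have cs: "length cs = k" using Suc.prems by (simp add: as)
  have "(rotation n ^^ Suc k) (pure_tensor (word c (as @ bs)))
    = rotation n (block_swap (replicate k Algebra) (CA (Suc l))
        (move k (pure_tensor (word c cs)) \<otimes> pure_tensor (map Alg (a # bs))))"
    using Suc.IH[of cs "a # bs" "Suc l"] Suc.prems by (simp add: as)
  also have "\<dots> = block_swap (replicate (Suc k) Algebra) (CA l)
      (move (Suc k) (pure_tensor (word c as)) \<otimes> pure_tensor (map Alg bs))"
    unfolding as move_step[OF cs]
    by (rule rotation_swapped)
      (use Suc.prems linear_map_in[OF move_linear word_in_T[OF cs]] in simp_all)
  finally show ?case .
qed

text \<open>When \<open>C\<close> has moved past all letters, exchanging the two blocks is the flip.\<close>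

lemma full_rotation_flip_move:
  assumes "length as = n + 1"
  shows "(rotation n ^^ (n + 1)) (pure_tensor (word c as)) = flip (n + 1) (move (n + 1) (pure_tensor (word c as)))"
proof -
  let ?p = "replicate (n + 1) Algebra"
  let ?t = "move (n + 1) (pure_tensor (word c as))"
  have t: "?t \<in> T (?p @ [Coalgebra])"
    by (rule linear_map_in[OF move_linear word_in_T[OF assms]])
  have flip: "multilinear (?p @ [Coalgebra]) ([Coalgebra] @ ?p) (\<lambda>w. pure_tensor (last w # butlast w))"
  proof (rule multilinear_cong[OF block_swap_multilinear])
    fix w :: "('a, 'c) letter list" assume "w \<in> words (?p @ [Coalgebra])"
    then have "length w = Suc (n + 1)" by (auto dest: words_length)
    then show "pure_tensor (drop (length ?p) w @ take (length ?p) w) = pure_tensor (last w # butlast w)"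
      by (cases w rule: rev_cases) simp_all
  qed
  have "(rotation n ^^ (n + 1)) (pure_tensor (word c as)) = block_swap ?p [Coalgebra] (?t \<otimes> pure_tensor [])"
    using rotation_pow_word[of as "n + 1" "[]" 0 n c] assms by (simp add: CA_def)
  also have "\<dots> = block_swap ?p [Coalgebra] ?t" by (simp only: tconcat_empty[OF t])
  also have "\<dots> = lift (?p @ [Coalgebra]) (\<lambda>w. pure_tensor (last w # butlast w)) ?t"
  proof (rule linear_map_eqI[OF t block_swap_linear lift_linear[OF flip]])
    fix w :: "('a, 'c) letter list" assume w: "w \<in> words (?p @ [Coalgebra])"
    then obtain u v where uv: "w = u @ v" "u \<in> words ?p" "v \<in> words [Coalgebra]" by (rule words_append_E)
    then obtain x where "v = [x]" by (auto simp: words_def)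
    with uv lift_pure[OF flip w] show "block_swap ?p [Coalgebra] (pure_tensor w)
        = lift (?p @ [Coalgebra]) (\<lambda>w. pure_tensor (last w # butlast w)) (pure_tensor w)"
      by (simp only: block_swap_pure last_snoc butlast_snoc append_Cons append_Nil)
  qed
  finally show ?thesis by (simp only: flip_def)
qed


section \<open>Transposing to cochains\<close>

text \<open>The common form of all three kinds of operators, with sign \<open>s\<close>. Composing operators amounts to
  composing the chain maps in the opposite order (\<open>pullback_pullback\<close>).\<close>

definition pullback :: "nat \<Rightarrow> 'k \<Rightarrow> (('a, 'c, 'k) tensor \<Rightarrow> ('a, 'c, 'k) tensor)
    \<Rightarrow> (('a, 'c, 'k) tensor \<Rightarrow> 'k) \<Rightarrow> (('a, 'c, 'k) tensor \<Rightarrow> 'k)" where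
  "pullback m s F g = (\<lambda>t. if t \<in> T (CA (m + 1)) then s * g (F t) else 0)"

lemma coface_pullback: "coface n i = pullback (n + 1) 1 (face n i)"
  by (intro ext) (simp add: coface_def pullback_def)

lemma codegeneracy_pullback: "codegeneracy n j = pullback n 1 (degeneracy n j)"
  by (intro ext) (simp add: codegeneracy_def pullback_def)

lemma cyclic_operator_pullback: "cyclic_operator n = pullback n ((- 1) ^ n) (rotation n)"
  by (intro ext) (simp add: cyclic_operator_def pullback_def)

lemma cochains_add: "g \<in> cochains n \<Longrightarrow> s \<in> T (CA (n + 1)) \<Longrightarrow> t \<in> T (CA (n + 1)) \<Longrightarrow> g (tadd s t) = g s + g t"
  and cochains_scale: "g \<in> cochains n \<Longrightarrow> t \<in> T (CA (n + 1)) \<Longrightarrow> g (tscale r t) = r * g t"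
  and cochains_outside: "g \<in> cochains n \<Longrightarrow> t \<notin> T (CA (n + 1)) \<Longrightarrow> g t = 0"
  by (simp_all add: cochains_def)

lemma pullback_cochains:
  assumes "g \<in> cochains n" "linear_map (CA (m + 1)) (CA (n + 1)) F"
  shows "pullback m s F g \<in> cochains m"
  using assms(2) cochains_add[OF assms(1)] cochains_scale[OF assms(1)]
  unfolding cochains_def pullback_def linear_map_def
  by (simp add: T_add T_scale distrib_left)

text \<open>On pure tensors the right side is the defining condition, by \<open>full_rotation_flip_move\<close>; linearity
  extends it to all tensors.\<close>

lemma invariant_iff:
  "g \<in> invariant_cochains n \<longleftrightarrow> g \<in> cochains n \<and> (\<forall>t\<in>T (CA (n + 1)). g ((rotation n ^^ (n + 1)) t) = g t)"
proof (intro iffI conjI ballI)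
  assume g: "g \<in> invariant_cochains n"
  then show gc: "g \<in> cochains n" by (simp add: invariant_cochains_def)
  let ?R = "rotation n ^^ (n + 1)"
  have R: "linear_map (CA (n + 1)) (CA (n + 1)) ?R" by (rule rotation_pow_linear)
  fix t assume "t \<in> T (CA (n + 1))"
  then show "g (?R t) = g t"
  proof (induction rule: T_induct)
    case zero
    then show ?case by (simp only: linear_map_0[OF R])
  next
    case (step r w t)
    obtain c as where w: "w = word c as" "length as = n + 1" using step(1) by (auto simp: words_CA)
    have w_in: "pure_tensor w \<in> T (CA (n + 1))" by (rule pure_in_T[OF step(1)])
    have "g (?R (pure_tensor w)) = g (pure_tensor w)"
      unfolding w(1) full_rotation_flip_move[OF w(2)] using g w(2) by (simp add: invariant_cochains_def)
    moreover have "?R (tadd (tscale r (pure_tensor w)) t) = tadd (tscale r (?R (pure_tensor w))) (?R t)"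
      using R w_in step(2) by (simp only: linear_map_def T_scale)
    ultimately show ?case
      using w_in step(2,3) linear_map_in[OF R]
      by (simp only: cochains_add[OF gc] cochains_scale[OF gc] T_scale)
  qed
next
  assume g: "g \<in> cochains n \<and> (\<forall>t\<in>T (CA (n + 1)). g ((rotation n ^^ (n + 1)) t) = g t)"
  have "g (pure_tensor (word c as)) = g (flip (n + 1) (move (n + 1) (pure_tensor (word c as))))"
    if "length as = n + 1" for c as
    using g word_in_T[OF that, of c] unfolding full_rotation_flip_move[OF that, symmetric] by simp
  with g show "g \<in> invariant_cochains n" by (simp add: invariant_cochains_def)
qed

lemma invariant_cochain: "g \<in> invariant_cochains n \<Longrightarrow> g \<in> cochains n"
  by (simp add: invariant_iff)

lemma pullback_invariant:
  assumes g: "g \<in> invariant_cochains n" and F: "linear_map (CA (m + 1)) (CA (n + 1)) F"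
    and commute: "\<And>t. t \<in> T (CA (m + 1)) \<Longrightarrow> F ((rotation m ^^ (m + 1)) t) = (rotation n ^^ (n + 1)) (F t)"
  shows "pullback m s F g \<in> invariant_cochains m"
  unfolding invariant_iff
proof (intro conjI ballI)
  show "pullback m s F g \<in> cochains m" by (rule pullback_cochains[OF invariant_cochain[OF g] F])
  fix t assume t: "t \<in> T (CA (m + 1))"
  have "g (F ((rotation m ^^ (m + 1)) t)) = g (F t)"
    unfolding commute[OF t] using g linear_map_in[OF F t] unfolding invariant_iff by blast
  with t rotation_pow_in[OF t, of "m + 1"]
  show "pullback m s F g ((rotation m ^^ (m + 1)) t) = pullback m s F g t"
    by (simp only: pullback_def)
qed

lemma pullback_linear:
  assumes "linear_map (CA (m + 1)) (CA (n + 1)) F"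
    and "\<And>t. t \<in> T (CA (m + 1)) \<Longrightarrow> F ((rotation m ^^ (m + 1)) t) = (rotation n ^^ (n + 1)) (F t)"
  shows "linear_between (\<lambda>r g t. r * g t) (invariant_cochains n) (invariant_cochains m) (pullback m s F)"
  unfolding linear_between_def
  using pullback_invariant[OF _ assms] by (auto simp: pullback_def algebra_simps)

lemma pullback_pullback:
  assumes "linear_map (CA (m + 1)) (CA (n + 1)) F"
  shows "pullback m s F (pullback n r G g) = pullback m (s * r) (\<lambda>t. G (F t)) g"
  using linear_map_in[OF assms] by (intro ext) (simp add: pullback_def)

lemma pullback_cong:
  assumes "\<And>t. t \<in> T (CA (m + 1)) \<Longrightarrow> F t = G t" "r = s"
  shows "pullback m r F g = pullback m s G g"
  using assms by (intro ext) (simp add: pullback_def)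

lemma pullback_uminus: "- pullback m s F g = pullback m (- s) F g"
  by (intro ext) (simp add: pullback_def)

lemma pullback_scale: "(\<lambda>t. r * pullback m s F g t) = pullback m (r * s) F g"
  by (intro ext) (simp add: pullback_def)

lemma face_linear_degree: "i \<le> n + 1 \<Longrightarrow> linear_map (CA ((n + 1) + 1)) (CA (n + 1)) (face n i)"
  using face_linear[of i n] by simp

lemma degeneracy_linear_degree: "j \<le> n + 1 \<Longrightarrow> linear_map (CA (n + 1)) (CA ((n + 1) + 1)) (degeneracy n j)"
  using degeneracy_linear[of j n] by simp

lemma cyclic_operator_power:
  assumes "g \<in> cochains n"
  shows "(cyclic_operator n ^^ k) g = pullback n ((- 1) ^ (n * k)) (rotation n ^^ k) g"
proof (induction k)
  case 0
  show ?case using cochains_outside[OF assms] by (intro ext) (simp add: pullback_def)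
next
  case (Suc k)
  have "(cyclic_operator n ^^ Suc k) g
    = pullback n ((- 1) ^ n) (rotation n) (pullback n ((- 1) ^ (n * k)) (rotation n ^^ k) g)"
    using Suc by (simp add: cyclic_operator_pullback)
  also have "\<dots> = pullback n ((- 1) ^ n * (- 1) ^ (n * k)) (\<lambda>t. (rotation n ^^ k) (rotation n t)) g"
    by (rule pullback_pullback[OF rotation_linear])
  also have "\<dots> = pullback n ((- 1) ^ (n * Suc k)) (rotation n ^^ Suc k) g"
    by (rule pullback_cong) (simp_all add: funpow_swap1 power_add)
  finally show ?case .
qed

lemma vector_space_functions: "vector_space (\<lambda>(r::'k) (g::'x \<Rightarrow> 'k) t. r * g t)"
  by unfold_locales (auto simp: algebra_simps fun_eq_iff)

lemma invariant_cochains_cosimplicial: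
  "cosimplicial_module (\<lambda>r g t. r * g t) invariant_cochains coface codegeneracy"
proof (rule cosimplicial_module.intro[OF vector_space_functions])
  show "cosimplicial_module_axioms (\<lambda>r g t. r * g t) invariant_cochains coface codegeneracy"
  proof
    fix n
    have "module (\<lambda>(r::'k) (g::('a, 'c, 'k) tensor \<Rightarrow> 'k) t. r * g t)"
      using vector_space_functions by (simp add: module_iff_vector_space)
    then show "module.subspace (\<lambda>r g t. r * g t) (invariant_cochains n)"
      by (rule module.subspaceI) (auto simp: invariant_iff cochains_def algebra_simps)
  next
    fix i n :: nat assume i: "i \<le> n + 1"
    show "linear_between (\<lambda>r g t. r * g t) (invariant_cochains n) (invariant_cochains (n + 1)) (coface n i)"
      unfolding coface_pullback
      by (rule pullback_linear[OF face_linear_degree[OF i]]) (use face_full_rotation[OF i] in simp)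
  next
    fix j n :: nat assume j: "j \<le> n"
    show "linear_between (\<lambda>r g t. r * g t) (invariant_cochains (n + 1)) (invariant_cochains n) (codegeneracy n j)"
      unfolding codegeneracy_pullback
      by (rule pullback_linear[OF degeneracy_linear_degree])
        (use j degeneracy_full_rotation[OF j] in simp_all)
  next
    fix x n and i j :: nat assume ij: "i < j" "j \<le> n + 2"
    show "coface (n + 1) j (coface n i x) = coface (n + 1) i (coface n (j - 1) x)"
      unfolding coface_pullback
      using face_face[OF ij] ij
      by (subst (1 2) pullback_pullback[OF face_linear_degree])
        (auto intro!: pullback_cong simp: numeral_3_eq_3)
  next
    fix x n and i j :: nat assume ij: "i \<le> j" "j \<le> n"
    show "codegeneracy n j (codegeneracy (n + 1) i x) = codegeneracy n i (codegeneracy (n + 1) (j + 1) x)"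
      unfolding codegeneracy_pullback
      using degeneracy_degeneracy[OF ij] ij
      by (subst (1 2) pullback_pullback[OF degeneracy_linear_degree])
        (auto intro!: pullback_cong)
  next
    fix x n and i j :: nat assume ij: "i < j" "j \<le> n + 1"
    show "codegeneracy (n + 1) j (coface (n + 1) i x) = coface n i (codegeneracy n (j - 1) x)"
      unfolding codegeneracy_pullback coface_pullback
      using face_degeneracy_less[OF ij] ij
      by (subst pullback_pullback[OF degeneracy_linear_degree], simp,
          subst pullback_pullback[OF face_linear_degree])
        (auto intro!: pullback_cong)
  next
    fix x n and i j :: nat assume x: "x \<in> invariant_cochains n" and ij: "j \<le> n" "i = j \<or> i = j + 1"
    have "pullback n (1 * 1) (\<lambda>t. face n i (degeneracy n j t)) x = x"
      using face_degeneracy_same[OF ij] cochains_outside[OF invariant_cochain[OF x]]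
      by (intro ext) (simp add: pullback_def)
    then show "codegeneracy n j (coface n i x) = x"
      unfolding codegeneracy_pullback coface_pullback
      using ij by (subst pullback_pullback[OF degeneracy_linear_degree]) simp_all
  next
    fix x n and i j :: nat assume ij: "j + 1 < i" "i \<le> n + 2"
    show "codegeneracy (n + 1) j (coface (n + 1) i x) = coface n (i - 1) (codegeneracy n j x)"
      unfolding codegeneracy_pullback coface_pullback
      using face_degeneracy_greater[OF ij] ij
      by (subst pullback_pullback[OF degeneracy_linear_degree], simp,
          subst pullback_pullback[OF face_linear_degree])
        (auto intro!: pullback_cong)
  qed
qed

lemma invariant_cochains_cocyclic:
  "cocyclic_module (\<lambda>r g t. r * g t) invariant_cochains coface codegeneracy cyclic_operator"
proof (rule cocyclic_module.intro[OF invariant_cochains_cosimplicial])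
  show "cocyclic_module_axioms (\<lambda>r g t. r * g t) invariant_cochains coface codegeneracy cyclic_operator"
  proof
    fix n
    show "linear_between (\<lambda>r g t. r * g t) (invariant_cochains n) (invariant_cochains n) (cyclic_operator n)"
      unfolding cyclic_operator_pullback
      by (rule pullback_linear[OF rotation_linear]) (simp only: funpow_swap1)
  next
    fix x n assume x: "x \<in> invariant_cochains n"
    have "(- 1 :: 'k) ^ (n * (n + 1)) = 1" by simp
    then show "(cyclic_operator n ^^ (n + 1)) x = x"
      using x unfolding cyclic_operator_power[OF invariant_cochain[OF x]]
      by (intro ext) (auto simp: pullback_def invariant_iff cochains_outside simp del: funpow.simps)
  next
    fix x n and i :: nat assume "1 \<le> i" "i \<le> n + 1"
    then obtain k where k: "i = Suc k" "k \<le> n" by (cases i) auto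
    have "coface n i (cyclic_operator n x)
      = pullback (n + 1) (1 * (- 1) ^ n) (\<lambda>t. rotation n (face n i t)) x"
      unfolding coface_pullback cyclic_operator_pullback
      by (rule pullback_pullback[OF face_linear_degree]) (use k in simp)
    also have "\<dots> = pullback (n + 1) (- ((- 1) ^ (n + 1) * 1)) (\<lambda>t. face n (i - 1) (rotation (n + 1) t)) x"
      by (rule pullback_cong) (use rotation_face[of k n] k in simp_all)
    also have "\<dots> = - cyclic_operator (n + 1) (coface n (i - 1) x)"
      unfolding coface_pullback cyclic_operator_pullback pullback_pullback[OF rotation_linear] pullback_uminus ..
    finally show "coface n i (cyclic_operator n x) = - cyclic_operator (n + 1) (coface n (i - 1) x)" .
  next
    fix x n
    have "coface n 0 x = pullback (n + 1) ((- 1) ^ (n + 1) * ((- 1) ^ (n + 1) * 1))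
        (\<lambda>t. face n (n + 1) (rotation (n + 1) t)) x"
      unfolding coface_pullback
      by (rule pullback_cong) (simp_all add: face_zero_rotation flip: power_mult_distrib)
    then show "coface n 0 x = (\<lambda>t. (- 1) ^ (n + 1) * cyclic_operator (n + 1) (coface n (n + 1) x) t)"
      unfolding coface_pullback cyclic_operator_pullback pullback_pullback[OF rotation_linear] pullback_scale .
  next
    fix x n and i :: nat assume "1 \<le> i" "i \<le> n"
    then obtain k where k: "i = Suc k" "k < n" by (cases i) auto
    have "codegeneracy n i (cyclic_operator (n + 1) x)
      = pullback n (1 * (- 1) ^ (n + 1)) (\<lambda>t. rotation (n + 1) (degeneracy n i t)) x"
      unfolding codegeneracy_pullback cyclic_operator_pullback
      by (rule pullback_pullback[OF degeneracy_linear_degree]) (use k in simp)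
    also have "\<dots> = pullback n (- ((- 1) ^ n * 1)) (\<lambda>t. degeneracy n (i - 1) (rotation n t)) x"
      by (rule pullback_cong) (use rotation_degeneracy[of k n] k in simp_all)
    also have "\<dots> = - cyclic_operator n (codegeneracy n (i - 1) x)"
      unfolding codegeneracy_pullback cyclic_operator_pullback pullback_pullback[OF rotation_linear] pullback_uminus ..
    finally show "codegeneracy n i (cyclic_operator (n + 1) x) = - cyclic_operator n (codegeneracy n (i - 1) x)" .
  next
    fix x n
    have "codegeneracy n 0 (cyclic_operator (n + 1) (cyclic_operator (n + 1) x))
      = pullback n (1 * ((- 1) ^ (n + 1) * (- 1) ^ (n + 1))) (\<lambda>t. rotation (n + 1) (rotation (n + 1) (degeneracy n 0 t))) x"
      unfolding codegeneracy_pullback cyclic_operator_pullback pullback_pullback[OF rotation_linear]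
      by (rule pullback_pullback[OF degeneracy_linear_degree]) simp
    also have "\<dots> = pullback n ((- 1) ^ n * ((- 1) ^ n * 1)) (\<lambda>t. degeneracy n n (rotation n t)) x"
      by (rule pullback_cong) (simp_all add: rotation_rotation_degeneracy[simplified] flip: power_mult_distrib)
    also have "\<dots> = (\<lambda>t. (- 1) ^ n * cyclic_operator n (codegeneracy n n x) t)"
      unfolding codegeneracy_pullback cyclic_operator_pullback pullback_pullback[OF rotation_linear] pullback_scale ..
    finally show "codegeneracy n 0 (cyclic_operator (n + 1) (cyclic_operator (n + 1) x))
      = (\<lambda>t. (- 1) ^ n * cyclic_operator n (codegeneracy n n x) t)" .
  qed
qed

end

theorem proposition6p2:
  fixes sA :: "'k::field \<Rightarrow> 'a::{ring, monoid_mult} \<Rightarrow> 'a"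
    and sC :: "'k \<Rightarrow> 'c::ab_group_add \<Rightarrow> 'c"
    and \<Delta> :: "'c \<Rightarrow> ('a, 'c, 'k) tensor"
    and \<epsilon> :: "'c \<Rightarrow> 'k"
    and \<psi> :: "('a, 'c, 'k) tensor \<Rightarrow> ('a, 'c, 'k) tensor"
  assumes "entwining_structure sA sC \<Delta> \<epsilon> \<psi>"
  shows "cocyclic_module (\<lambda>r g t. r * g t)
    (entwining_data.invariant_cochains sA sC \<psi>)
    (entwining_data.coface sA sC \<psi>)
    (entwining_data.codegeneracy sA sC)
    (entwining_data.cyclic_operator sA sC \<psi>)"
  using assms by (rule entwining_structure.invariant_cochains_cocyclic)

end
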